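(* Let $\{\xi_n\}$, for $n\in\mathbb{N}$, $n\ge \ell^{1/c_1}$, be a sequence of isotropic random vectors such that for each $n$, $\xi_n$ is $\mathbb{R}^n$-valued and has a log-concave density with respect to Lebesgue measure on $\mathbb{R}^n$. Let $\zeta\sim\mathcal{N}(0,I_\ell)$, and consider an ensemble of static team problems with parameters $Q,W,\{R_n\},\{\xi_n\}$, where each $R_n\in\mathbb{R}^{n\times \ell}$ is chosen uniformly and independently from $V_{n,\ell}$ and independently of $\{\xi_k\}$. Let $\gamma_n^*$ be a solution of the $n$-th problem in this ensemble and let $\gamma_G$ be the solution of the Gaussian problem. Then, $\{R_n\}$-almost surely, $$\lim_{n\to\infty} J(\gamma_n^*;\xi_n)=J(\gamma_G;\zeta).$$
   Context: A random vector $X\in\mathbb{R}^n$ is isotropic if $\mathbb{E}[X]=0$ and its covariance matrix is $I_n$. A density $f$ on $\mathbb{R}^n$ is log-concave if $f=\exp(-G)$ with $G$ convex. $V_{n,\ell}=\{R\in\mathbb{R}^{n\times\ell}: R^\top R=I_\ell\}$ is the Stiefel manifold, with its uniform (rotation-invariant) probability measure. $\varphi_\ell$ is the standard normal density on $\mathbb{R}^\ell$, and $f_Y$ is the density of $Y$. Universal constants. $C,c_1,c_2,c_3,c_4>0$ are fixed universal constants for which the following theorem of Eldan and Klartag holds: if $X$ is an isotropic random vector in $\mathbb{R}^n$ with log-concave density, $1\le \ell\le n^{c_1}$ is an integer, and $R$ is uniformly distributed on $V_{n,\ell}$ and independent of $X$, then with probability (over $R$) at least $1-C\exp(-n^{c_2})$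 one has $\left|\frac{f_{R^\top X}(x)}{\varphi_\ell(x)}-1\right|\le \frac{C}{n^{c_3}}$ for all $x\in\mathbb{R}^\ell$ with $\|x\|\le n^{c_4}$ (here $f_{R^\top X}$ is the density of $R^\top X$ with $R$ held fixed). Ensemble of static team problems. Fix $m,\ell_1,\dots,\ell_m\in\mathbb{N}$, $\ell=m+\sum_{i=1}^m\ell_i$, a symmetric positive definite $Q\in\mathbb{R}^{m\times m}$, and $W\in\mathbb{R}^{\ell\times\ell}$, partitioned by rows as $W=[W_0;W_1;\dots;W_m]$ with $W_0\in\mathbb{R}^{m\times\ell}$, $W_i\in\mathbb{R}^{\ell_i\times\ell}$. The $n$-th problem has random $R_n$ uniform on $V_{n,\ell}$ (the $R_n$ independent of each other and of all other random variables), matrices $S=W_0R_n^\top$ and $H_i=W_iR_n^\top$ (with each $H_i$ of full row rank), environmental randomness $\xi_n$, and cost $L(u,\xi)=\frac12u^\top Qu+u^\top S\xi+\frac12\xi^\top S^\top Q^{-1}S\xi$. It consists in minimizing, for given $R_n$, $$J(\gamma;\xi_n)=\mathbb{E}\big[L(\gamma^1(H_1\xi_n),\dots,\gamma^m(H_m\xi_n),\xi_n)\big]$$ over all $\gamma=(\gamma^1,\dots,\gamma^m)$ with each $\gamma^i:\mathbb{R}^{\ell_i}\to\mathbb{R}$ measurable; the expectation is over $\xi_n$ only, so $\gamma_n^*$ and $J(\gamma_n^*;\xi_n)$ depend on $R_n$. Gaussian problem. For $\zeta\sim\mathcal{N}(0,I_\ell)$, $J(\gamma;\zeta)$ is the same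 expression with $\xi_n$ replaced by $\zeta$ and $R_n$ by $I_\ell$, i.e. $S=W_0$, $H_i=W_i$. $\gamma_G$ is its minimizer over measurable $\gamma$; it is known to be unique and linear. "$\{R_n\}$-almost surely" means almost surely with respect to the law of the sequence $\{R_n\}$. *)

theory Defs
  imports "HOL-Probability.Probability" "Jordan_Normal_Form.DL_Rank"
    "Jordan_Normal_Form.Gauss_Jordan_Elimination"
begin

(* The ambient dimension n is quantified inside the statement, so it cannot be a type index;
   hence vectors and matrices that carry their dimensions. *)

no_notation inner (infix "\<bullet>" 70)
no_notation vec_nth (infixl "$" 90)
hide_const (open) Finite_Cartesian_Product.vec Finite_Cartesian_Product.mat
hide_const (open) Finite_Cartesian_Product.transpose Cartesian_Space.rank

section \<open>Measure spaces of vectors and matrices\<close>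

definition borel_vec :: "nat \<Rightarrow> real vec measure" where
  "borel_vec n = embed_measure (\<Pi>\<^sub>M i\<in>{..<n}. borel) (Matrix.vec n)"

definition lborel_vec :: "nat \<Rightarrow> real vec measure" where
  "lborel_vec n = embed_measure (\<Pi>\<^sub>M i\<in>{..<n}. lborel) (Matrix.vec n)"

definition borel_mat :: "nat \<Rightarrow> nat \<Rightarrow> real mat measure" where
  "borel_mat n l = embed_measure (\<Pi>\<^sub>M ij\<in>{..<n} \<times> {..<l}. borel) (Matrix.mat n l)"

definition norm_vec :: "real vec \<Rightarrow> real" where
  "norm_vec x = sqrt (x \<bullet> x)"

definition std_normal_vec_density :: "nat \<Rightarrow> real vec \<Rightarrow> real" where
  "std_normal_vec_density l x = (\<Prod>i<l. std_normal_density (x $ i))"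

section \<open>Isotropic and log-concave random vectors\<close>

definition isotropic :: "'a measure \<Rightarrow> nat \<Rightarrow> ('a \<Rightarrow> real vec) \<Rightarrow> bool" where
  "isotropic M n X \<longleftrightarrow>
     X \<in> measurable M (borel_vec n) \<and>
     (\<forall>i<n. integrable M (\<lambda>\<omega>. X \<omega> $ i) \<and> (\<integral>\<omega>. X \<omega> $ i \<partial>M) = 0) \<and>
     (\<forall>i<n. \<forall>j<n.
        integrable M (\<lambda>\<omega>. (X \<omega> $ i - (\<integral>\<omega>'. X \<omega>' $ i \<partial>M)) * (X \<omega> $ j - (\<integral>\<omega>'. X \<omega>' $ j \<partial>M))) \<and>
        (\<integral>\<omega>. (X \<omega> $ i - (\<integral>\<omega>'. X \<omega>' $ i \<partial>M)) * (X \<omega> $ j - (\<integral>\<omega>'. X \<omega>' $ j \<partial>M)) \<partial>M)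
          = 1\<^sub>m n $$ (i, j))"

(* As usual for log-concavity, the convex function may take the value +infinity, so that
   densities may vanish (e.g. uniform densities on convex bodies). *)
definition convex_ereal :: "nat \<Rightarrow> (real vec \<Rightarrow> ereal) \<Rightarrow> bool" where
  "convex_ereal n G \<longleftrightarrow>
     (\<forall>x\<in>carrier_vec n. G x \<noteq> -\<infinity>) \<and>
     (\<forall>x\<in>carrier_vec n. \<forall>y\<in>carrier_vec n. \<forall>t. 0 \<le> t \<and> t \<le> 1 \<longrightarrow>
        G (t \<cdot>\<^sub>v x + (1 - t) \<cdot>\<^sub>v y) \<le> ereal t * G x + ereal (1 - t) * G y)"

definition exp_neg :: "ereal \<Rightarrow> real" where
  "exp_neg a = (if a = \<infinity> then 0 else exp (- real_of_ereal a))"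

definition log_concave :: "nat \<Rightarrow> (real vec \<Rightarrow> real) \<Rightarrow> bool" where
  "log_concave n f \<longleftrightarrow>
     (\<exists>G. convex_ereal n G \<and> (\<forall>x\<in>carrier_vec n. f x = exp_neg (G x)))"

definition has_log_concave_density :: "'a measure \<Rightarrow> nat \<Rightarrow> ('a \<Rightarrow> real vec) \<Rightarrow> bool" where
  "has_log_concave_density M n X \<longleftrightarrow>
     (\<exists>f. log_concave n f \<and> distributed M (lborel_vec n) X (\<lambda>x. ennreal (f x)))"

section \<open>Uniform distribution on the Stiefel manifold\<close>

definition stiefel :: "nat \<Rightarrow> nat \<Rightarrow> real mat set" where
  "stiefel n l = {R \<in> carrier_mat n l. transpose_mat R * R = 1\<^sub>m l}"

(* The orthogonal group O(n) acts transitively on the Stiefel manifold by left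
   multiplication, so there is at most one such measure. *)
definition stiefel_uniform :: "nat \<Rightarrow> nat \<Rightarrow> real mat measure \<Rightarrow> bool" where
  "stiefel_uniform n l \<sigma> \<longleftrightarrow>
     prob_space \<sigma> \<and> sets \<sigma> = sets (borel_mat n l) \<and>
     (AE R in \<sigma>. R \<in> stiefel n l) \<and>
     (\<forall>U\<in>stiefel n n. distr \<sigma> \<sigma> (\<lambda>R. U * R) = \<sigma>)"

section \<open>The constants of Eldan and Klartag\<close>

(* Only the law of the random vector matters, since it is independent of the random matrix;
   hence X is taken to be the identity on (real vec, \<mu>).  A density is determined up to
   null sets, so the pointwise bound is asserted for some version of it. *)
definition eldan_klartag :: "real \<Rightarrow> real \<Rightarrow> real \<Rightarrow> real \<Rightarrow> real \<Rightarrow> bool" where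
  "eldan_klartag C c1 c2 c3 c4 \<longleftrightarrow>
     (\<forall>n l \<mu> \<sigma>. prob_space \<mu> \<longrightarrow> sets \<mu> = sets (borel_vec n) \<longrightarrow>
        isotropic \<mu> n (\<lambda>x. x) \<longrightarrow> has_log_concave_density \<mu> n (\<lambda>x. x) \<longrightarrow>
        1 \<le> l \<longrightarrow> real l \<le> real n powr c1 \<longrightarrow> stiefel_uniform n l \<sigma> \<longrightarrow>
        measure \<sigma> {R \<in> space \<sigma>. \<exists>f. (\<forall>x. 0 \<le> f x) \<and>
            distributed \<mu> (lborel_vec l) (\<lambda>x. transpose_mat R *\<^sub>v x) (\<lambda>x. ennreal (f x)) \<and>
            (\<forall>x\<in>carrier_vec l. norm_vec x \<le> real n powr c4 \<longrightarrow>
               \<bar>f x / std_normal_vec_density l x - 1\<bar> \<le> C / real n powr c3)}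
          \<ge> 1 - C * exp (- (real n powr c2)))"

(* Independence of random variables with values in different types, for which
   prob_space.indep_var is not applicable. *)
definition indep_rvs ::
  "'a measure \<Rightarrow> 'b measure \<Rightarrow> ('a \<Rightarrow> 'b) \<Rightarrow> 'c measure \<Rightarrow> ('a \<Rightarrow> 'c) \<Rightarrow> bool" where
  "indep_rvs M A X B Y \<longleftrightarrow>
     X \<in> measurable M A \<and> Y \<in> measurable M B \<and>
     prob_space.indep_set M (sets (vimage_algebra (space M) X A))
       (sets (vimage_algebra (space M) Y B))"

section \<open>Static team problems\<close>

definition pos_def :: "nat \<Rightarrow> real mat \<Rightarrow> bool" where
  "pos_def m Q \<longleftrightarrow> Q \<in> carrier_mat m m \<and> transpose_mat Q = Q \<and>
     (\<forall>v\<in>carrier_vec m. v \<noteq> 0\<^sub>v m \<longrightarrow> 0 < v \<bullet> (Q *\<^sub>v v))"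

definition full_row_rank :: "real mat \<Rightarrow> bool" where
  "full_row_rank A \<longleftrightarrow> vec_space.rank (dim_row A) A = dim_row A"

definition team_cost :: "real mat \<Rightarrow> real mat \<Rightarrow> real vec \<Rightarrow> real vec \<Rightarrow> real" where
  "team_cost Q S u x =
     1/2 * (u \<bullet> (Q *\<^sub>v u)) + u \<bullet> (S *\<^sub>v x)
     + 1/2 * (x \<bullet> (transpose_mat S *\<^sub>v (the (mat_inverse Q) *\<^sub>v (S *\<^sub>v x))))"

(* Players are numbered 0, ..., m - 1; player i applies the policy \<gamma> i to H i *\<^sub>v x.
   For positive definite Q the cost is non-negative (team_cost_nonneg below), so its expectation
   always exists in [0, \<infinity>] and non-integrable costs count as \<infinity>. *)
definition expected_cost ::
  "'a measure \<Rightarrow> nat \<Rightarrow> real mat \<Rightarrow> real mat \<Rightarrow> (nat \<Rightarrow> real mat) \<Rightarrow> (nat \<Rightarrow> real vec \<Rightarrow> real)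
    \<Rightarrow> ('a \<Rightarrow> real vec) \<Rightarrow> ennreal" where
  "expected_cost M m Q S H \<gamma> X =
     (\<integral>\<^sup>+\<omega>. ennreal (team_cost Q S (Matrix.vec m (\<lambda>i. \<gamma> i (H i *\<^sub>v X \<omega>))) (X \<omega>)) \<partial>M)"

definition policies :: "nat \<Rightarrow> (nat \<Rightarrow> nat) \<Rightarrow> (nat \<Rightarrow> real vec \<Rightarrow> real) set" where
  "policies m ls = {\<gamma>. \<forall>i<m. \<gamma> i \<in> borel_measurable (borel_vec (ls i))}"

definition team_solution ::
  "'a measure \<Rightarrow> nat \<Rightarrow> (nat \<Rightarrow> nat) \<Rightarrow> real mat \<Rightarrow> real mat \<Rightarrow> (nat \<Rightarrow> real mat)
    \<Rightarrow> ('a \<Rightarrow> real vec) \<Rightarrow> (nat \<Rightarrow> real vec \<Rightarrow> real) \<Rightarrow> bool" where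
  "team_solution M m ls Q S H X \<gamma> \<longleftrightarrow> \<gamma> \<in> policies m ls \<and>
     (\<forall>\<gamma>'\<in>policies m ls. expected_cost M m Q S H \<gamma> X \<le> expected_cost M m Q S H \<gamma>' X)"

definition rows_from :: "nat \<Rightarrow> nat \<Rightarrow> real mat \<Rightarrow> real mat" where
  "rows_from a k W = Matrix.mat k (dim_col W) (\<lambda>(p, q). W $$ (a + p, q))"

(* W is partitioned as [W\<^sub>0; W\<^sub>1; ...; W\<^sub>m] with block sizes m, ls 0, ..., ls (m - 1);
   W_obs m ls W i is the block of player i, i.e. W\<^sub>i\<^sub>+\<^sub>1. *)
definition W_zero :: "nat \<Rightarrow> real mat \<Rightarrow> real mat" where
  "W_zero m W = rows_from 0 m W"

definition W_obs :: "nat \<Rightarrow> (nat \<Rightarrow> nat) \<Rightarrow> real mat \<Rightarrow> nat \<Rightarrow> real mat" where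
  "W_obs m ls W i = rows_from (m + (\<Sum>j<i. ls j)) (ls i) W"

definition S_of :: "nat \<Rightarrow> real mat \<Rightarrow> real mat \<Rightarrow> real mat" where
  "S_of m W R = W_zero m W * transpose_mat R"

definition H_of :: "nat \<Rightarrow> (nat \<Rightarrow> nat) \<Rightarrow> real mat \<Rightarrow> real mat \<Rightarrow> nat \<Rightarrow> real mat" where
  "H_of m ls W R i = W_obs m ls W i * transpose_mat R"

section \<open>Basic facts\<close>

lemma inj_on_vec: "inj_on (Matrix.vec n) (space (\<Pi>\<^sub>M i\<in>{..<n}. (borel :: real measure)))"
proof (rule inj_onI)
  fix f g :: "nat \<Rightarrow> real"
  assume f: "f \<in> space (\<Pi>\<^sub>M i\<in>{..<n}. borel)" and g: "g \<in> space (\<Pi>\<^sub>M i\<in>{..<n}. borel)"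
    and eq: "Matrix.vec n f = Matrix.vec n g"
  have "f i = g i" if "i < n" for i
    using arg_cong[OF eq, of "\<lambda>v. v $ i"] that by simp
  then show "f = g"
    using f g by (intro PiE_ext[of f "{..<n}" "\<lambda>_. UNIV" g]) (auto simp: space_PiM)
qed

lemma inj_on_mat:
  "inj_on (Matrix.mat n l) (space (\<Pi>\<^sub>M ij\<in>{..<n} \<times> {..<l}. (borel :: real measure)))"
proof (rule inj_onI)
  fix f g :: "nat \<times> nat \<Rightarrow> real"
  assume f: "f \<in> space (\<Pi>\<^sub>M ij\<in>{..<n} \<times> {..<l}. borel)"
    and g: "g \<in> space (\<Pi>\<^sub>M ij\<in>{..<n} \<times> {..<l}. borel)"
    and eq: "Matrix.mat n l f = Matrix.mat n l g"
  have "f (i, j) = g (i, j)" if "i < n" "j < l" for i j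
    using arg_cong[OF eq, of "\<lambda>A. A $$ (i, j)"] that by simp
  then show "f = g"
    using f g by (intro PiE_ext[of f "{..<n} \<times> {..<l}" "\<lambda>_. UNIV" g]) (auto simp: space_PiM)
qed

lemma sets_lborel_vec: "sets (lborel_vec n) = sets (borel_vec n)"
proof -
  have s: "sets (\<Pi>\<^sub>M i\<in>{..<n}. (lborel :: real measure)) = sets (\<Pi>\<^sub>M i\<in>{..<n}. borel)"
    by (rule sets_PiM_cong) auto
  then have "space (\<Pi>\<^sub>M i\<in>{..<n}. (lborel :: real measure)) = space (\<Pi>\<^sub>M i\<in>{..<n}. borel)"
    by (rule sets_eq_imp_space_eq)
  with s show ?thesis
    unfolding lborel_vec_def borel_vec_def
    by (simp add: sets_embed_measure' inj_on_vec)
qed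

lemma space_borel_vec: "space (borel_vec n) = carrier_vec n"
proof -
  have "v \<in> Matrix.vec n ` (\<Pi>\<^sub>E i\<in>{..<n}. UNIV)" if "v \<in> carrier_vec n" for v :: "real vec"
    using that by (intro image_eqI[of _ _ "\<lambda>i\<in>{..<n}. v $ i"]) auto
  then show ?thesis
    unfolding borel_vec_def space_embed_measure by (auto simp: space_PiM)
qed

lemma space_borel_mat: "space (borel_mat n l) = carrier_mat n l"
proof -
  have "A \<in> Matrix.mat n l ` (\<Pi>\<^sub>E i\<in>{..<n} \<times> {..<l}. UNIV)" if "A \<in> carrier_mat n l" for A :: "real mat"
    using that by (intro image_eqI[of _ _ "\<lambda>ij\<in>{..<n} \<times> {..<l}. A $$ ij"]) auto
  then show ?thesis
    unfolding borel_mat_def space_embed_measure by (auto simp: space_PiM)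
qed

lemma measurable_vec_index:
  assumes "i < n" shows "(\<lambda>v. v $ i) \<in> borel_measurable (borel_vec n)"
  unfolding borel_vec_def
proof (rule measurable_embed_measure1)
  have "(\<lambda>f. f i) \<in> borel_measurable (\<Pi>\<^sub>M i\<in>{..<n}. (borel :: real measure))"
    using assms by (intro measurable_component_singleton) auto
  then show "(\<lambda>f. Matrix.vec n f $ i) \<in> borel_measurable (\<Pi>\<^sub>M i\<in>{..<n}. (borel :: real measure))"
    using assms by simp
qed

lemma measurable_mat_index:
  assumes "i < n" "j < l" shows "(\<lambda>A. A $$ (i, j)) \<in> borel_measurable (borel_mat n l)"
  unfolding borel_mat_def
proof (rule measurable_embed_measure1)
  have "(\<lambda>f. f (i, j)) \<in> borel_measurable (\<Pi>\<^sub>M ij\<in>{..<n} \<times> {..<l}. (borel :: real measure))"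
    using assms by (intro measurable_component_singleton) auto
  then show "(\<lambda>f. Matrix.mat n l f $$ (i, j))
      \<in> borel_measurable (\<Pi>\<^sub>M ij\<in>{..<n} \<times> {..<l}. (borel :: real measure))"
    using assms by simp
qed

lemma measurable_vecI:
  assumes "\<And>i. i < n \<Longrightarrow> (\<lambda>x. f x i) \<in> borel_measurable M"
  shows "(\<lambda>x. Matrix.vec n (f x)) \<in> measurable M (borel_vec n)"
proof -
  have "(\<lambda>x. \<lambda>i\<in>{..<n}. f x i) \<in> measurable M (\<Pi>\<^sub>M i\<in>{..<n}. borel)"
    using assms by (intro measurable_restrict) auto
  then have "(\<lambda>x. Matrix.vec n (\<lambda>i\<in>{..<n}. f x i)) \<in> measurable M (borel_vec n)"
    unfolding borel_vec_def
    by (rule measurable_compose[OF _ measurable_embed_measure2'[OF inj_on_vec]])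
  moreover have "Matrix.vec n (\<lambda>i\<in>{..<n}. f x i) = Matrix.vec n (f x)" for x
    by (intro eq_vecI) auto
  ultimately show ?thesis by simp
qed

lemma pos_def_inverse:
  assumes "pos_def m Q"
  shows "Q * the (mat_inverse Q) = 1\<^sub>m m" "the (mat_inverse Q) * Q = 1\<^sub>m m"
    "the (mat_inverse Q) \<in> carrier_mat m m"
proof -
  have Q: "Q \<in> carrier_mat m m" using assms by (simp add: pos_def_def)
  have "det Q \<noteq> 0"
  proof
    assume "det Q = 0"
    then obtain v where v: "v \<in> carrier_vec m" "v \<noteq> 0\<^sub>v m" "Q *\<^sub>v v = 0\<^sub>v m"
      using det_0_iff_vec_prod_zero_field[OF Q] by auto
    then have "v \<bullet> (Q *\<^sub>v v) = 0" by simp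
    with v assms show False by (auto simp: pos_def_def)
  qed
  then have "Q \<in> Units (ring_mat TYPE(real) m undefined)"
    using det_non_zero_imp_unit[OF Q] by simp
  then obtain B where "mat_inverse Q = Some B"
    using mat_inverse(1)[OF Q] by fastforce
  with mat_inverse(2)[OF Q this]
  show "Q * the (mat_inverse Q) = 1\<^sub>m m" "the (mat_inverse Q) * Q = 1\<^sub>m m"
    "the (mat_inverse Q) \<in> carrier_mat m m" by auto
qed

lemma team_cost_nonneg:
  assumes Q: "pos_def m Q" and S: "S \<in> carrier_mat m n"
    and u: "u \<in> carrier_vec m" and x: "x \<in> carrier_vec n"
  shows "0 \<le> team_cost Q S u x"
proof -
  define P where "P = the (mat_inverse Q)"
  define y where "y = S *\<^sub>v x"
  define w where "w = P *\<^sub>v y"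
  have Qc: "Q \<in> carrier_mat m m" and Qt: "transpose_mat Q = Q"
    using Q by (auto simp: pos_def_def)
  have Pc: "P \<in> carrier_mat m m" and QP: "Q * P = 1\<^sub>m m"
    using pos_def_inverse[OF Q] by (auto simp: P_def)
  have y: "y \<in> carrier_vec m" unfolding y_def using S x by simp
  have w: "w \<in> carrier_vec m" unfolding w_def using Pc y by simp
  have Qw: "Q *\<^sub>v w = y"
    unfolding w_def using assoc_mult_mat_vec[OF Qc Pc y] QP y by simp
  have sym: "a \<bullet> (Q *\<^sub>v b) = (Q *\<^sub>v a) \<bullet> b" if "a \<in> carrier_vec m" "b \<in> carrier_vec m" for a b
    using transpose_vec_mult_scalar[OF Qc that(2) that(1)] Qt by simp
  have "x \<bullet> (transpose_mat S *\<^sub>v w) = y \<bullet> w"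
  proof -
    have "x \<bullet> (transpose_mat S *\<^sub>v w) = (transpose_mat S *\<^sub>v w) \<bullet> x"
      using S w x by (intro comm_scalar_prod[of _ n]) auto
    also have "\<dots> = w \<bullet> y"
      using transpose_vec_mult_scalar[OF S x w] by (simp add: y_def)
    also have "\<dots> = y \<bullet> w" by (rule comm_scalar_prod[OF w y])
    finally show ?thesis .
  qed
  then have cost: "team_cost Q S u x = 1/2 * (u \<bullet> (Q *\<^sub>v u)) + u \<bullet> y + 1/2 * (y \<bullet> w)"
    by (simp add: team_cost_def P_def y_def w_def)
  have Qu: "Q *\<^sub>v u \<in> carrier_vec m" using Qc u by simp
  have "(u + w) \<bullet> (Q *\<^sub>v (u + w)) = (u + w) \<bullet> (Q *\<^sub>v u + y)"
    using mult_add_distrib_mat_vec[OF Qc u w] Qw by simp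
  also have "\<dots> = u \<bullet> (Q *\<^sub>v u) + u \<bullet> y + (w \<bullet> (Q *\<^sub>v u) + w \<bullet> y)"
    using u w y Qu by (simp add: add_scalar_prod_distrib[of _ m] scalar_prod_add_distrib[of _ m])
  also have "w \<bullet> (Q *\<^sub>v u) = u \<bullet> y"
    using sym[OF w u] Qw comm_scalar_prod[OF u y] by simp
  also have "w \<bullet> y = y \<bullet> w" by (rule comm_scalar_prod[OF w y])
  finally have sq: "team_cost Q S u x = 1/2 * ((u + w) \<bullet> (Q *\<^sub>v (u + w)))"
    by (simp add: cost)
  have "0 \<le> (u + w) \<bullet> (Q *\<^sub>v (u + w))"
  proof (cases "u + w = 0\<^sub>v m")
    case True
    then show ?thesis using Qc by simp
  next
    case False
    then show ?thesis using Q u w by (auto simp: pos_def_def intro!: less_imp_le)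
  qed
  with sq show ?thesis by simp
qed

end

theory Submission
  imports Defs "HOL-Real_Asymp.Real_Asymp"
begin

text \<open>
  With \<open>R\<close> held fixed, the cost of a policy in the \<open>n\<close>-th problem depends on \<open>\<xi>\<close> only through the
  projection \<open>R\<^sup>T \<xi>\<close>, and the \<open>n\<close>-th problem is the Gaussian problem with the law of \<open>\<zeta>\<close> replaced by
  the law \<open>\<nu>\<^sub>n\<close> of \<open>R\<^sup>T \<xi>\<close> (\<open>expected_cost_projected\<close>).  The exceptional probabilities in the theorem of
  Eldan and Klartag are summable, so by the Borel-Cantelli lemma almost every sequence \<open>R\<close> has, for
  all large \<open>n\<close>, a density of \<open>\<nu>\<^sub>n\<close> whose ratio to the Gaussian density tends to 1 uniformly on balls
  of growing radius.  It remains to prove a statement about one such sequence.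

  Completing the square turns the cost into a coercive quadratic form in \<open>\<gamma>\<^sub>i (W\<^sub>i x) + w\<^sub>i x\<close> with
  linear \<open>w\<^sub>i\<close>.  The density bound says that \<open>\<nu>\<^sub>n\<close> is eventually at least \<open>c\<close> times the Gaussian law \<open>\<mu>\<close> on
  every fixed ball, for every \<open>c < 1\<close>; outside the balls there is no pointwise control, but isotropy
  of \<open>\<xi>\<close> and orthonormality of the columns of \<open>R\<close> give \<open>\<nu>\<^sub>n\<close> exactly the second moments of \<open>\<mu>\<close>.  These
  two facts suffice (\<open>minimal_cost_tendsto\<close>).

  Lower bound: the \<open>n\<close>-th optimal cost is at least \<open>c\<close> times the least cost that any policy can collect
  on the ball of radius \<open>k\<close> under \<open>\<mu>\<close>.  As \<open>k\<close> grows, these local minimal costs increase to the global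
  one (\<open>policy_of_local_values\<close>): near-minimizers for growing balls are Cauchy in mean square on each
  ball by the parallelogram identity, hence converge almost everywhere along a subsequence, and
  Fatou's lemma bounds the cost of the limit policy.

  Upper bound: a bounded policy \<open>\<eta>\<close> nearly attains the Gaussian optimum (\<open>bounded_near_optimal\<close>), and its
  cost is dominated by a multiple of \<open>H x = 1 + \<bar>x\<bar>\<^sup>2\<close>.  The minorization bounds the integral of the
  nonnegative difference between this multiple and the cost from below, and since the integral of \<open>H\<close> is
  the same under \<open>\<nu>\<^sub>n\<close> and \<open>\<mu>\<close>, it bounds the cost of \<open>\<eta>\<close> under \<open>\<nu>\<^sub>n\<close> from above.
\<close>

section \<open>Quadratic forms\<close>

definition quad :: "nat \<Rightarrow> (nat \<Rightarrow> nat \<Rightarrow> real) \<Rightarrow> (nat \<Rightarrow> real) \<Rightarrow> real" where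
  "quad m A v = (\<Sum>i<m. \<Sum>j<m. A i j * v i * v j)"

lemma quad_parallelogram:
  "quad m A (\<lambda>i. a i + b i) + quad m A (\<lambda>i. a i - b i) = 2 * quad m A a + 2 * quad m A b"
  unfolding quad_def sum_distrib_left sum.distrib[symmetric]
  by (intro sum.cong refl) (simp add: algebra_simps)

lemma quad_scale: "quad m A (\<lambda>i. c * v i) = c\<^sup>2 * quad m A v"
  unfolding quad_def sum_distrib_left
  by (intro sum.cong refl) (simp add: power2_eq_square)

lemma quad_le: "quad m A v \<le> (\<Sum>i<m. \<Sum>j<m. \<bar>A i j\<bar>) * (\<Sum>i<m. (v i)\<^sup>2)"
proof -
  have "A i j * v i * v j \<le> \<bar>A i j\<bar> * (\<Sum>i<m. (v i)\<^sup>2)" if "i < m" "j < m" for i j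
  proof -
    have s: "(v k)\<^sup>2 \<le> (\<Sum>i<m. (v i)\<^sup>2)" if "k < m" for k
      using that by (intro member_le_sum) auto
    have "\<bar>v i * v j\<bar> \<le> ((v i)\<^sup>2 + (v j)\<^sup>2) / 2"
      using sum_squares_bound[of "\<bar>v i\<bar>" "\<bar>v j\<bar>"] by (simp add: abs_mult)
    also have "\<dots> \<le> (\<Sum>i<m. (v i)\<^sup>2)" using s[OF that(1)] s[OF that(2)] by simp
    finally have "\<bar>A i j\<bar> * \<bar>v i * v j\<bar> \<le> \<bar>A i j\<bar> * (\<Sum>i<m. (v i)\<^sup>2)"
      by (intro mult_left_mono) auto
    then show ?thesis
      using abs_ge_self[of "A i j * (v i * v j)"] unfolding abs_mult[of "A i j"] mult.assoc
      by linarith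
  qed
  then show ?thesis
    unfolding quad_def sum_distrib_right by (intro sum_mono) auto
qed

lemma tendsto_quad:
  assumes "\<And>i. i < m \<Longrightarrow> ((\<lambda>n. v n i) \<longlongrightarrow> u i) F"
  shows "((\<lambda>n. quad m A (v n)) \<longlongrightarrow> quad m A u) F"
  unfolding quad_def using assms by (intro tendsto_sum tendsto_mult tendsto_const) auto

lemma quad_cong: "(\<And>i. i < m \<Longrightarrow> u i = v i) \<Longrightarrow> quad m A u = quad m A v"
  unfolding quad_def by (intro sum.cong) auto

section \<open>Quadratic team problems over an arbitrary law\<close>

lemma ennreal_less_mult:
  fixes a b :: ennreal
  assumes "a < b"
  obtains c where "0 \<le> c" "c < 1" "a < ennreal c * b"
proof (cases b)
  case (real r)
  obtain s where s: "a = ennreal s" "0 \<le> s"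
    using assms real by (cases a) auto
  have sr: "s < r" using assms s real by (simp add: ennreal_less_iff)
  show thesis
  proof
    show "0 \<le> (s + r) / 2 / r" "(s + r) / 2 / r < 1"
      using s sr by (auto simp: field_simps)
    have "ennreal ((s + r) / 2 / r) * b = ennreal ((s + r) / 2)"
      using s sr real by (simp add: ennreal_mult[symmetric])
    then show "a < ennreal ((s + r) / 2 / r) * b"
      using s sr by (simp add: ennreal_less_iff)
  qed
next
  case top
  show thesis
  proof
    show "a < ennreal (1/2) * b" using assms top by (simp add: ennreal_mult_top)
  qed auto
qed

text \<open>
  If the weighted squares of the increments have a finite sum, the increments decay like \<open>2\<^sup>-\<^sup>j\<close>.  The
  indicators allow an initial segment without any bound.
\<close>

lemma convergent_of_weighted_squares:
  fixes a :: "nat \<Rightarrow> real"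
  assumes fin: "(\<Sum>j. ennreal (4 ^ j * (a (Suc j) - a j)\<^sup>2) * indicator (B j) x) < \<infinity>"
    and ev: "eventually (\<lambda>j. x \<in> B j) sequentially"
  shows "convergent a"
proof -
  obtain r where r: "(\<Sum>j. ennreal (4 ^ j * (a (Suc j) - a j)\<^sup>2) * indicator (B j) x) = ennreal r" "0 \<le> r"
    using fin by (cases "\<Sum>j. ennreal (4 ^ j * (a (Suc j) - a j)\<^sup>2) * indicator (B j) x") auto
  have term_le: "f j \<le> suminf f" for f :: "nat \<Rightarrow> ennreal" and j
    using sum_le_suminf[of f "{j}"] by simp
  have bound: "norm (a (Suc j) - a j) \<le> sqrt r * (1/2) ^ j" if "x \<in> B j" for j
  proof -
    have "ennreal (4 ^ j * (a (Suc j) - a j)\<^sup>2) * indicator (B j) x \<le> ennreal r"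
      unfolding r(1)[symmetric] by (rule term_le)
    then have "4 ^ j * (a (Suc j) - a j)\<^sup>2 \<le> r"
      using that r(2) by (simp add: ennreal_le_iff)
    then have "(a (Suc j) - a j)\<^sup>2 \<le> r * (1/4) ^ j"
      by (simp add: field_simps power_one_over)
    then have "sqrt ((a (Suc j) - a j)\<^sup>2) \<le> sqrt (r * (1/4) ^ j)"
      by (rule real_sqrt_le_mono)
    also have "(1/4::real) ^ j = ((1/2) ^ j)\<^sup>2"
      unfolding power2_eq_square power_mult_distrib[symmetric] by simp
    also have "sqrt (r * ((1/2) ^ j)\<^sup>2) = sqrt r * (1/2) ^ j"
      by (simp add: real_sqrt_mult)
    finally show ?thesis by simp
  qed
  have "summable (\<lambda>j. a (Suc j) - a j)"
  proof (rule summable_comparison_test_ev)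
    show "eventually (\<lambda>j. norm (a (Suc j) - a j) \<le> sqrt r * (1/2) ^ j) sequentially"
      using ev by eventually_elim (rule bound)
    show "summable (\<lambda>j. sqrt r * (1/2::real) ^ j)"
      by (intro summable_mult summable_geometric) simp
  qed
  then have "convergent (\<lambda>n. \<Sum>j<n. a (Suc j) - a j)"
    by (simp add: summable_iff_convergent)
  then have "convergent (\<lambda>n. a n - a 0)"
    by (simp add: sum_lessThan_telescope)
  then have "convergent (\<lambda>n. (a n - a 0) + a 0)"
    by (intro convergent_add convergent_const)
  then show ?thesis by simp
qed

text \<open>
  The law \<open>\<mu>\<close> of the environment is not a parameter: the same policies are compared under different
  laws on the measurable space \<open>E\<close>.  The offset \<open>w\<close> is what the completed square adds to the actions.
\<close>

locale quadratic_team =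
  fixes m :: nat and A :: "nat \<Rightarrow> nat \<Rightarrow> real" and \<kappa> :: real
    and E :: "'e measure" and Obs :: "nat \<Rightarrow> 'b measure"
    and Y :: "nat \<Rightarrow> 'e \<Rightarrow> 'b" and w :: "nat \<Rightarrow> 'e \<Rightarrow> real"
  assumes kappa_pos: "0 < \<kappa>"
    and quad_nonneg: "\<And>v. 0 \<le> quad m A v"
    and coercive: "\<And>v i. i < m \<Longrightarrow> (v i)\<^sup>2 \<le> \<kappa> * quad m A v"
    and Y_meas: "\<And>i. i < m \<Longrightarrow> Y i \<in> measurable E (Obs i)"
    and w_meas: "\<And>i. i < m \<Longrightarrow> w i \<in> borel_measurable E"
begin

definition admissible :: "(nat \<Rightarrow> 'b \<Rightarrow> real) set" where
  "admissible = {\<gamma>. \<forall>i<m. \<gamma> i \<in> borel_measurable (Obs i)}"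

definition cost :: "(nat \<Rightarrow> 'b \<Rightarrow> real) \<Rightarrow> 'e \<Rightarrow> real" where
  "cost \<gamma> x = quad m A (\<lambda>i. \<gamma> i (Y i x) + w i x)"

lemma cost_nonneg: "0 \<le> cost \<gamma> x"
  unfolding cost_def by (rule quad_nonneg)

lemma measurable_policy:
  assumes "\<gamma> \<in> admissible" "i < m"
  shows "(\<lambda>x. \<gamma> i (Y i x)) \<in> borel_measurable E"
  using assms Y_meas[OF assms(2)] unfolding admissible_def by (auto intro: measurable_compose)

lemma measurable_cost: "\<gamma> \<in> admissible \<Longrightarrow> cost \<gamma> \<in> borel_measurable E"
  unfolding cost_def[abs_def] quad_def
  using measurable_policy w_meas
  by (intro borel_measurable_sum borel_measurable_times borel_measurable_add) auto

lemma cost_midpoint: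
  "4 * cost (\<lambda>i y. (\<gamma> i y + \<eta> i y) / 2) x + quad m A (\<lambda>i. \<gamma> i (Y i x) - \<eta> i (Y i x))
     = 2 * cost \<gamma> x + 2 * cost \<eta> x"
proof -
  let ?a = "\<lambda>i. \<gamma> i (Y i x) + w i x" and ?b = "\<lambda>i. \<eta> i (Y i x) + w i x"
  have "quad m A (\<lambda>i. ?a i + ?b i) = quad m A (\<lambda>i. 2 * ((\<gamma> i (Y i x) + \<eta> i (Y i x)) / 2 + w i x))"
    by (intro arg_cong[of _ _ "quad m A"] ext) (simp add: field_simps)
  also have "\<dots> = 4 * cost (\<lambda>i y. (\<gamma> i y + \<eta> i y) / 2) x"
    by (subst quad_scale) (simp add: cost_def)
  finally show ?thesis
    using quad_parallelogram[of m A ?a ?b] by (simp add: cost_def)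
qed

lemma midpoint_admissible:
  "\<gamma> \<in> admissible \<Longrightarrow> \<eta> \<in> admissible \<Longrightarrow> (\<lambda>i y. (\<gamma> i y + \<eta> i y) / 2) \<in> admissible"
  unfolding admissible_def by (auto intro!: borel_measurable_divide borel_measurable_add)

text \<open>
  The midpoint of the two policies costs at least \<open>V\<close>, so the parallelogram identity leaves at most
  \<open>2 (V + d) + 2 (V + d) - 4 V\<close> for the form of their difference, and coercivity transfers this to each
  player.
\<close>

lemma near_minimizers_close:
  fixes V d :: ennreal
  assumes \<gamma>: "\<gamma> \<in> admissible" and \<eta>: "\<eta> \<in> admissible" and "i < m"
    and A: "A' \<in> sets \<mu>" and \<mu>: "sets \<mu> = sets E"
    and low: "V \<le> (\<integral>\<^sup>+x. ennreal (cost (\<lambda>i y. (\<gamma> i y + \<eta> i y) / 2) x) * indicator A' x \<partial>\<mu>)"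
    and up1: "(\<integral>\<^sup>+x. ennreal (cost \<gamma> x) * indicator A' x \<partial>\<mu>) \<le> V + d"
    and up2: "(\<integral>\<^sup>+x. ennreal (cost \<eta> x) * indicator A' x \<partial>\<mu>) \<le> V + d"
    and fin: "V < \<infinity>"
  shows "(\<integral>\<^sup>+x. ennreal ((\<gamma> i (Y i x) - \<eta> i (Y i x))\<^sup>2) * indicator A' x \<partial>\<mu>) \<le> ennreal (4 * \<kappa>) * d"
proof -
  note [measurable] = measurable_cost[OF \<gamma>, unfolded measurable_cong_sets[OF \<mu>[symmetric] refl]]
    measurable_cost[OF \<eta>, unfolded measurable_cong_sets[OF \<mu>[symmetric] refl]]
    measurable_cost[OF midpoint_admissible[OF \<gamma> \<eta>], unfolded measurable_cong_sets[OF \<mu>[symmetric] refl]]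
    A
  let ?mid = "cost (\<lambda>i y. (\<gamma> i y + \<eta> i y) / 2)"
  let ?D = "\<lambda>x. quad m A (\<lambda>i. \<gamma> i (Y i x) - \<eta> i (Y i x))"
  have D_eq: "?D = (\<lambda>x. 2 * cost \<gamma> x + 2 * cost \<eta> x - 4 * ?mid x)"
  proof
    show "?D x = 2 * cost \<gamma> x + 2 * cost \<eta> x - 4 * ?mid x" for x
      using cost_midpoint[of \<gamma> \<eta> x] by linarith
  qed
  have [measurable]: "?D \<in> borel_measurable \<mu>" unfolding D_eq by measurable
  let ?I = "\<lambda>f. \<integral>\<^sup>+x. ennreal (f x) * indicator A' x \<partial>\<mu>"
  have "4 * ?I ?mid + ?I ?D = (\<integral>\<^sup>+x. 4 * (ennreal (?mid x) * indicator A' x) + ennreal (?D x) * indicator A' x \<partial>\<mu>)"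
    by (simp add: nn_integral_add nn_integral_cmult)
  also have "\<dots> = (\<integral>\<^sup>+x. 2 * (ennreal (cost \<gamma> x) * indicator A' x) + 2 * (ennreal (cost \<eta> x) * indicator A' x) \<partial>\<mu>)"
  proof (rule nn_integral_cong)
    fix x
    have "4 * ennreal (?mid x) + ennreal (?D x) = 2 * ennreal (cost \<gamma> x) + 2 * ennreal (cost \<eta> x)"
    proof -
      have "ennreal (4 * ?mid x + ?D x) = ennreal (2 * cost \<gamma> x + 2 * cost \<eta> x)"
        by (simp only: cost_midpoint)
      then show ?thesis
        by (simp add: ennreal_mult cost_nonneg quad_nonneg)
    qed
    then show "4 * (ennreal (?mid x) * indicator A' x) + ennreal (?D x) * indicator A' x
        = 2 * (ennreal (cost \<gamma> x) * indicator A' x) + 2 * (ennreal (cost \<eta> x) * indicator A' x)"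
      by (auto simp: indicator_def)
  qed
  also have "\<dots> = 2 * ?I (cost \<gamma>) + 2 * ?I (cost \<eta>)"
    by (simp add: nn_integral_add nn_integral_cmult)
  also have "\<dots> \<le> 2 * (V + d) + 2 * (V + d)"
    using up1 up2 by (intro add_mono mult_left_mono) auto
  also have "\<dots> = 4 * V + 4 * d"
  proof -
    have "2 * a + 2 * a = 4 * a" for a :: ennreal
      by (subst distrib_right[symmetric]) simp
    from this[of "V + d"] show ?thesis by (simp add: distrib_left)
  qed
  finally have "4 * ?I ?mid + ?I ?D \<le> 4 * V + 4 * d" .
  moreover have "4 * V + ?I ?D \<le> 4 * ?I ?mid + ?I ?D"
    by (intro add_right_mono mult_left_mono low) simp
  ultimately have "4 * V + ?I ?D \<le> 4 * V + 4 * d"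
    by (rule order_trans[rotated])
  then have D: "?I ?D \<le> 4 * d"
    using fin by (subst (asm) ennreal_add_left_cancel_le) (auto simp: ennreal_mult_eq_top_iff)
  have "(\<integral>\<^sup>+x. ennreal ((\<gamma> i (Y i x) - \<eta> i (Y i x))\<^sup>2) * indicator A' x \<partial>\<mu>)
      \<le> (\<integral>\<^sup>+x. ennreal \<kappa> * (ennreal (?D x) * indicator A' x) \<partial>\<mu>)"
  proof (rule nn_integral_mono)
    fix x
    have "ennreal ((\<gamma> i (Y i x) - \<eta> i (Y i x))\<^sup>2) \<le> ennreal (\<kappa> * ?D x)"
      using coercive[OF \<open>i < m\<close>, of "\<lambda>i. \<gamma> i (Y i x) - \<eta> i (Y i x)"] by (rule ennreal_leI)
    also have "\<dots> = ennreal \<kappa> * ennreal (?D x)"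
      using kappa_pos by (simp add: ennreal_mult quad_nonneg)
    finally show "ennreal ((\<gamma> i (Y i x) - \<eta> i (Y i x))\<^sup>2) * indicator A' x
        \<le> ennreal \<kappa> * (ennreal (?D x) * indicator A' x)"
      by (simp add: indicator_def)
  qed
  also have "\<dots> = ennreal \<kappa> * ?I ?D" by (simp add: nn_integral_cmult)
  also have "\<dots> \<le> ennreal \<kappa> * (4 * d)" using D by (intro mult_left_mono) auto
  also have "\<dots> = ennreal (4 * \<kappa>) * d" using kappa_pos by (simp add: ennreal_mult ac_simps)
  finally show ?thesis .
qed


text \<open>
  The least cost that can be collected inside a region; only the behaviour of the policies on
  that region matters.
\<close>

definition local_value :: "'e measure \<Rightarrow> 'e set \<Rightarrow> ennreal" where
  "local_value \<mu> A' = (INF \<gamma>\<in>admissible. \<integral>\<^sup>+x. ennreal (cost \<gamma> x) * indicator A' x \<partial>\<mu>)"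

lemma local_value_mono:
  "A' \<subseteq> B' \<Longrightarrow> local_value \<mu> A' \<le> local_value \<mu> B'"
  unfolding local_value_def
  by (intro INF_mono') (auto intro!: nn_integral_mono split: split_indicator)

text \<open>
  Existence of a minimizer by the direct method, with almost everywhere convergence in place of weak
  compactness: near-minimizers of the local problems are close in mean square on the smaller of two
  regions, so a fast subsequence converges almost everywhere.  The pointwise limit of policies in
  the observations is again a policy in the observations, and Fatou's lemma compares its cost with
  the local values.
\<close>

lemma policy_of_local_values:
  assumes \<mu>: "sets \<mu> = sets E"
    and A: "\<And>k. A' k \<in> sets \<mu>" and inc: "incseq A'" and UN: "(\<Union>k. A' k) = space \<mu>"
    and bound: "\<And>k. local_value \<mu> (A' k) \<le> b" and fin: "b < \<infinity>"
  shows "\<exists>\<gamma>\<in>admissible. (\<integral>\<^sup>+x. ennreal (cost \<gamma> x) \<partial>\<mu>) \<le> b"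
proof -
  define V where "V k = local_value \<mu> (A' k)" for k
  define S where "S = (SUP k. V k)"
  \<comment> \<open>The tolerances beat the weights \<open>4 ^ j\<close> under which the increments are summed below.\<close>
  define \<delta> :: "nat \<Rightarrow> ennreal" where "\<delta> j = ennreal ((1/16) ^ j)" for j
  have \<delta>_pos: "0 < \<delta> j" for j unfolding \<delta>_def by simp
  have Vmono: "V k \<le> V k'" if "k \<le> k'" for k k'
    unfolding V_def using that inc by (intro local_value_mono) (auto dest: incseqD)
  have Sb: "S \<le> b" unfolding S_def V_def using bound by (intro SUP_least) auto
  then have S_fin: "S < \<infinity>" using fin by auto
  have V_le: "V k \<le> S" for k unfolding S_def by (intro SUP_upper) auto
  have V_fin: "V k < \<infinity>" for k using V_le[of k] S_fin by auto
  have "\<exists>k. S < V k + \<delta> j" for j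
    using SUP_approx_ennreal[of "(1/16) ^ j" UNIV S V, OF _ _ S_def] S_fin by (auto simp: \<delta>_def)
  then obtain kk where kk: "S < V (kk j) + \<delta> j" for j by metis
  \<comment> \<open>The sum makes \<open>k\<close> monotone and the summand \<open>j\<close> makes it unbounded.\<close>
  define k where "k j = j + (\<Sum>i\<le>j. kk i)" for j
  have k_ge: "j \<le> k j" "kk j \<le> k j" for j
    unfolding k_def using member_le_sum[of j "{..j}" kk] by auto
  have k_Suc: "k j \<le> k (Suc j)" for j unfolding k_def by simp
  have SV: "S \<le> V (k j) + \<delta> j" for j
    using kk[of j] Vmono[OF k_ge(2)[of j]] by (meson add_right_mono less_imp_le order_trans)
  define B where "B j = A' (k j)" for j
  have B_sets: "B j \<in> sets \<mu>" for j unfolding B_def by (rule A)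
  have B_Suc: "B j \<subseteq> B (Suc j)" for j
    unfolding B_def by (rule incseqD[OF inc k_Suc])
  have B_ev: "eventually (\<lambda>j. x \<in> B j) sequentially" if "x \<in> space \<mu>" for x
  proof -
    have "x \<in> (\<Union>k. A' k)" using that by (simp only: UN)
    then obtain k0 where k0: "x \<in> A' k0" by (rule UN_E)
    have "x \<in> B j" if "k0 \<le> j" for j
      unfolding B_def by (rule subsetD[OF incseqD[OF inc order_trans[OF that k_ge(1)]] k0])
    then show ?thesis by (rule eventually_sequentiallyI)
  qed
  have "\<exists>\<gamma>. \<gamma> \<in> admissible \<and>
      (\<integral>\<^sup>+x. ennreal (cost \<gamma> x) * indicator (B j) x \<partial>\<mu>) < V (k j) + \<delta> j" for j
  proof -
    have "V (k j) < V (k j) + \<delta> j"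
      using V_fin[of "k j"] \<delta>_pos[of j] by (simp add: ennreal_add_left_cancel_less)
    then have "local_value \<mu> (B j) < V (k j) + \<delta> j" by (simp add: V_def B_def)
    then show ?thesis unfolding local_value_def INF_less_iff by blast
  qed
  then have "\<exists>g. \<forall>j. g j \<in> admissible \<and>
      (\<integral>\<^sup>+x. ennreal (cost (g j) x) * indicator (B j) x \<partial>\<mu>) < V (k j) + \<delta> j"
    by (intro choice allI)
  then obtain g where g: "\<And>j. g j \<in> admissible"
    and g_less: "\<And>j. (\<integral>\<^sup>+x. ennreal (cost (g j) x) * indicator (B j) x \<partial>\<mu>) < V (k j) + \<delta> j"
    by blast
  \<comment> \<open>On \<open>B j\<close> the next near-minimizer is almost as good as the current one: enlarging the region
      only increases its cost, and all local values from \<open>k j\<close> on agree up to \<open>\<delta> j\<close>.\<close>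
  have diff: "(\<integral>\<^sup>+x. ennreal ((g (Suc j) i (Y i x) - g j i (Y i x))\<^sup>2) * indicator (B j) x \<partial>\<mu>)
      \<le> ennreal (4 * \<kappa>) * (2 * \<delta> j)" if "i < m" for i j
  proof (rule near_minimizers_close[OF g g that B_sets \<mu>])
    show "V (k j) \<le> (\<integral>\<^sup>+x. ennreal (cost (\<lambda>i y. (g (Suc j) i y + g j i y) / 2) x) * indicator (B j) x \<partial>\<mu>)"
      unfolding V_def local_value_def B_def
      by (rule INF_lower) (rule midpoint_admissible[OF g g])
    show "(\<integral>\<^sup>+x. ennreal (cost (g j) x) * indicator (B j) x \<partial>\<mu>) \<le> V (k j) + 2 * \<delta> j"
    proof -
      have "\<delta> j \<le> 2 * \<delta> j" using mult_right_mono[of "1::ennreal" 2 "\<delta> j"] by simp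
      then show ?thesis using g_less[of j] by (meson add_left_mono less_imp_le order_trans)
    qed
    have "(\<integral>\<^sup>+x. ennreal (cost (g (Suc j)) x) * indicator (B j) x \<partial>\<mu>)
        \<le> (\<integral>\<^sup>+x. ennreal (cost (g (Suc j)) x) * indicator (B (Suc j)) x \<partial>\<mu>)"
      using B_Suc[of j] by (intro nn_integral_mono) (auto split: split_indicator)
    also have "\<dots> \<le> S + \<delta> j"
    proof -
      have "\<delta> (Suc j) \<le> \<delta> j" unfolding \<delta>_def by (intro ennreal_leI) simp
      then show ?thesis using g_less[of "Suc j"] V_le[of "k (Suc j)"]
        by (meson add_mono less_imp_le order_trans)
    qed
    also have "\<dots> \<le> V (k j) + \<delta> j + \<delta> j" by (intro add_right_mono SV)
    finally show "(\<integral>\<^sup>+x. ennreal (cost (g (Suc j)) x) * indicator (B j) x \<partial>\<mu>) \<le> V (k j) + 2 * \<delta> j"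
      by (simp add: mult_2 add.assoc)
    show "V (k j) < \<infinity>" by (rule V_fin)
  qed
  have conv: "AE x in \<mu>. convergent (\<lambda>j. g j i (Y i x))" if i: "i < m" for i
  proof -
    let ?f = "\<lambda>j x. ennreal (4 ^ j * (g (Suc j) i (Y i x) - g j i (Y i x))\<^sup>2) * indicator (B j) x"
    have [measurable]: "(\<lambda>x. g j i (Y i x)) \<in> borel_measurable \<mu>" for j
      using measurable_policy[OF g i] by (simp cong: measurable_cong_sets add: \<mu>)
    note B_sets[measurable]
    have "(\<integral>\<^sup>+x. (\<Sum>j. ?f j x) \<partial>\<mu>) = (\<Sum>j. \<integral>\<^sup>+x. ?f j x \<partial>\<mu>)"
      by (rule nn_integral_suminf) measurable
    also have "\<dots> \<le> (\<Sum>j. ennreal (8 * \<kappa> * (1/4) ^ j))"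
    proof (intro suminf_le summableI)
      fix j
      have "(\<integral>\<^sup>+x. ?f j x \<partial>\<mu>) =
          (\<integral>\<^sup>+x. ennreal (4 ^ j) * (ennreal ((g (Suc j) i (Y i x) - g j i (Y i x))\<^sup>2) * indicator (B j) x) \<partial>\<mu>)"
        by (intro nn_integral_cong) (simp add: ennreal_mult mult.assoc)
      also have "\<dots> = ennreal (4 ^ j) *
          (\<integral>\<^sup>+x. ennreal ((g (Suc j) i (Y i x) - g j i (Y i x))\<^sup>2) * indicator (B j) x \<partial>\<mu>)"
        by (rule nn_integral_cmult) measurable
      also have "\<dots> \<le> ennreal (4 ^ j) * (ennreal (4 * \<kappa>) * (2 * \<delta> j))"
        by (intro mult_left_mono diff i) auto
      also have "\<dots> = ennreal (4 ^ j * (4 * \<kappa> * (2 * (1/16) ^ j)))"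
        using kappa_pos unfolding \<delta>_def
        by (simp add: ennreal_mult[symmetric] ennreal_numeral[symmetric] del: ennreal_numeral)
      also have "4 ^ j * (4 * \<kappa> * (2 * (1/16) ^ j)) = 8 * \<kappa> * (4 ^ j * (1/16) ^ j)"
        by simp
      also have "4 ^ j * (1/16) ^ j = (1/4::real) ^ j"
        by (subst power_mult_distrib[symmetric]) simp
      finally show "(\<integral>\<^sup>+x. ?f j x \<partial>\<mu>) \<le> ennreal (8 * \<kappa> * (1/4) ^ j)" .
    qed
    also have "\<dots> = ennreal (\<Sum>j. 8 * \<kappa> * (1/4) ^ j)"
      using kappa_pos by (intro suminf_ennreal2 summable_mult summable_geometric) auto
    finally have "(\<integral>\<^sup>+x. (\<Sum>j. ?f j x) \<partial>\<mu>) \<noteq> \<infinity>"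
      by (auto simp: top_unique)
    then have "AE x in \<mu>. (\<Sum>j. ?f j x) \<noteq> \<infinity>"
      by (intro nn_integral_PInf_AE) measurable
    then show ?thesis
      using AE_space
    proof eventually_elim
      case (elim x)
      show ?case
        by (rule convergent_of_weighted_squares[where B = B and x = x])
           (use elim B_ev in \<open>auto simp: less_top\<close>)
    qed
  qed
  \<comment> \<open>Where the limit does not exist, \<open>lim\<close> is an unspecified constant; this keeps \<open>h i\<close> measurable
      and concerns a null set only.\<close>
  define h where "h i y = lim (\<lambda>j. g j i y)" for i y
  have h: "h \<in> admissible"
    using g unfolding admissible_def h_def by (auto intro!: borel_measurable_lim_metric)
  have "AE x in \<mu>. \<forall>i\<in>{..<m}. convergent (\<lambda>j. g j i (Y i x))"
    using conv by (intro AE_finite_allI) auto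
  then have "AE x in \<mu>. ennreal (cost h x) = liminf (\<lambda>j. ennreal (cost (g j) x) * indicator (B j) x)"
    using AE_space
  proof eventually_elim
    case (elim x)
    have "(\<lambda>j. cost (g j) x) \<longlonglongrightarrow> cost h x"
      unfolding cost_def h_def using elim(1)
      by (intro tendsto_quad tendsto_add tendsto_const) (auto simp: convergent_LIMSEQ_iff)
    then have "(\<lambda>j. ennreal (cost (g j) x)) \<longlonglongrightarrow> ennreal (cost h x)"
      by (rule tendsto_ennrealI)
    moreover have "eventually (\<lambda>j. ennreal (cost (g j) x) = ennreal (cost (g j) x) * indicator (B j) x) sequentially"
      using B_ev[OF elim(2)] by eventually_elim simp
    ultimately have "(\<lambda>j. ennreal (cost (g j) x) * indicator (B j) x) \<longlonglongrightarrow> ennreal (cost h x)"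
      by (rule Lim_transform_eventually)
    then show ?case by (intro lim_imp_Liminf[symmetric]) auto
  qed
  then have "(\<integral>\<^sup>+x. ennreal (cost h x) \<partial>\<mu>) = (\<integral>\<^sup>+x. liminf (\<lambda>j. ennreal (cost (g j) x) * indicator (B j) x) \<partial>\<mu>)"
    by (rule nn_integral_cong_AE)
  also have "\<dots> \<le> liminf (\<lambda>j. \<integral>\<^sup>+x. ennreal (cost (g j) x) * indicator (B j) x \<partial>\<mu>)"
  proof (rule nn_integral_liminf)
    show "(\<lambda>x. ennreal (cost (g j) x) * indicator (B j) x) \<in> borel_measurable \<mu>" for j
      using measurable_cost[OF g[of j]] B_sets[of j] by (simp cong: measurable_cong_sets add: \<mu>)
  qed
  also have "\<dots> \<le> liminf (\<lambda>j. b + \<delta> j)"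
  proof (intro Liminf_mono always_eventually allI)
    fix j
    show "(\<integral>\<^sup>+x. ennreal (cost (g j) x) * indicator (B j) x \<partial>\<mu>) \<le> b + \<delta> j"
      using g_less[of j] V_le[of "k j"] Sb by (meson add_mono less_imp_le order_refl order_trans)
  qed
  also have "liminf (\<lambda>j. b + \<delta> j) = b"
  proof -
    have "(\<lambda>j. (1/16::real) ^ j) \<longlonglongrightarrow> 0"
      by (rule LIMSEQ_power_zero) simp
    then have d: "\<delta> \<longlonglongrightarrow> 0"
      unfolding \<delta>_def using tendsto_ennrealI[of "\<lambda>j. (1/16) ^ j" 0 sequentially] by simp
    have "(\<lambda>j. b + \<delta> j) \<longlonglongrightarrow> b + 0"
      by (rule tendsto_add[OF tendsto_const d])
    then have "liminf (\<lambda>j. b + \<delta> j) = b + 0"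
      by (rule lim_imp_Liminf[OF sequentially_bot])
    then show ?thesis by simp
  qed
  finally have "(\<integral>\<^sup>+x. ennreal (cost h x) \<partial>\<mu>) \<le> b" .
  then show ?thesis using h by blast
qed

lemma cost_le_squares:
  "cost \<gamma> x \<le> (\<Sum>i<m. \<Sum>j<m. \<bar>A i j\<bar>) * (\<Sum>i<m. 2 * (\<gamma> i (Y i x))\<^sup>2 + 2 * (w i x)\<^sup>2)"
proof -
  have "cost \<gamma> x \<le> (\<Sum>i<m. \<Sum>j<m. \<bar>A i j\<bar>) * (\<Sum>i<m. (\<gamma> i (Y i x) + w i x)\<^sup>2)"
    unfolding cost_def by (rule quad_le)
  also have "\<dots> \<le> (\<Sum>i<m. \<Sum>j<m. \<bar>A i j\<bar>) * (\<Sum>i<m. 2 * (\<gamma> i (Y i x))\<^sup>2 + 2 * (w i x)\<^sup>2)"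
  proof (intro mult_left_mono sum_mono sum_nonneg)
    fix i
    show "(\<gamma> i (Y i x) + w i x)\<^sup>2 \<le> 2 * (\<gamma> i (Y i x))\<^sup>2 + 2 * (w i x)\<^sup>2"
      using sum_squares_bound[of "\<gamma> i (Y i x)" "w i x"] by (simp add: power2_sum)
  qed simp
  finally show ?thesis .
qed

lemma policy_square_le:
  assumes "i < m"
  shows "(\<gamma> i (Y i x))\<^sup>2 \<le> 2 * \<kappa> * cost \<gamma> x + 2 * (w i x)\<^sup>2"
proof -
  have "(\<gamma> i (Y i x) + w i x)\<^sup>2 \<le> \<kappa> * cost \<gamma> x"
    unfolding cost_def using coercive[OF assms, of "\<lambda>i. \<gamma> i (Y i x) + w i x"] .
  moreover have "(\<gamma> i (Y i x))\<^sup>2 \<le> 2 * (\<gamma> i (Y i x) + w i x)\<^sup>2 + 2 * (w i x)\<^sup>2"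
    using zero_le_power2[of "\<gamma> i (Y i x) + 2 * w i x"]
    by (simp add: power2_eq_square algebra_simps)
  ultimately show ?thesis by linarith
qed

text \<open>
  Truncating the actions at level \<open>K\<close> converges pointwise as \<open>K\<close> grows.  Coercivity makes the squared
  actions of a finite cost policy integrable, which provides the dominating function.
\<close>

lemma bounded_near_optimal:
  assumes \<mu>: "sets \<mu> = sets E" and \<gamma>: "\<gamma> \<in> admissible"
    and fin: "(\<integral>\<^sup>+x. ennreal (cost \<gamma> x) \<partial>\<mu>) < \<infinity>"
    and w_fin: "\<And>i. i < m \<Longrightarrow> (\<integral>\<^sup>+x. ennreal ((w i x)\<^sup>2) \<partial>\<mu>) < \<infinity>"
    and a: "(\<integral>\<^sup>+x. ennreal (cost \<gamma> x) \<partial>\<mu>) < a"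
  shows "\<exists>\<eta>\<in>admissible. \<exists>K. (\<forall>i<m. \<forall>y. \<bar>\<eta> i y\<bar> \<le> K) \<and> (\<integral>\<^sup>+x. ennreal (cost \<eta> x) \<partial>\<mu>) < a"
proof -
  define h where "h K i y = max (- real K) (min (real K) (\<gamma> i y))" for K i y
  have h_adm: "h K \<in> admissible" for K
    using \<gamma> unfolding admissible_def h_def[abs_def] by auto
  have h_le: "\<bar>h K i y\<bar> \<le> \<bar>\<gamma> i y\<bar>" and h_bd: "\<bar>h K i y\<bar> \<le> real K" for K i y
    unfolding h_def by auto
  define B where "B = (\<Sum>i<m. \<Sum>j<m. \<bar>A i j\<bar>)"
  have B: "0 \<le> B" unfolding B_def by (intro sum_nonneg) auto
  let ?D = "\<lambda>x. \<Sum>i<m. 4 * \<kappa> * cost \<gamma> x + 6 * (w i x)\<^sup>2"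
  have dom: "cost (h K) x \<le> B * ?D x" for K x
  proof -
    have "cost (h K) x \<le> B * (\<Sum>i<m. 2 * (h K i (Y i x))\<^sup>2 + 2 * (w i x)\<^sup>2)"
      unfolding B_def by (rule cost_le_squares)
    also have "\<dots> \<le> B * ?D x"
    proof (intro mult_left_mono[OF sum_mono B])
      fix i assume "i \<in> {..<m}"
      then have "(\<gamma> i (Y i x))\<^sup>2 \<le> 2 * \<kappa> * cost \<gamma> x + 2 * (w i x)\<^sup>2"
        by (intro policy_square_le) simp
      moreover have "(h K i (Y i x))\<^sup>2 \<le> (\<gamma> i (Y i x))\<^sup>2"
        using h_le[of K i "Y i x"] by (rule abs_le_square_iff[THEN iffD1])
      ultimately show "2 * (h K i (Y i x))\<^sup>2 + 2 * (w i x)\<^sup>2 \<le> 4 * \<kappa> * cost \<gamma> x + 6 * (w i x)\<^sup>2"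
        by linarith
    qed
    finally show ?thesis .
  qed
  have [measurable]: "cost \<gamma> \<in> borel_measurable \<mu>"
    using measurable_cost[OF \<gamma>] by (simp cong: measurable_cong_sets add: \<mu>)
  have hm: "cost (h K) \<in> borel_measurable \<mu>" for K
    using measurable_cost[OF h_adm] by (simp cong: measurable_cong_sets add: \<mu>)
  have wm: "w i \<in> borel_measurable \<mu>" if "i < m" for i
    using w_meas[OF that] by (simp cong: measurable_cong_sets add: \<mu>)
  have cost_int: "integrable \<mu> (cost \<gamma>)"
    using fin by (intro integrableI_nonneg) (auto simp: cost_nonneg)
  have w_int: "integrable \<mu> (\<lambda>x. (w i x)\<^sup>2)" if "i < m" for i
    using w_fin[OF that] wm[OF that] by (intro integrableI_nonneg) auto
  have D_int: "integrable \<mu> (\<lambda>x. B * ?D x)"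
    using cost_int w_int
    by (intro integrable_mult_right Bochner_Integration.integrable_sum Bochner_Integration.integrable_add) auto
  have lim: "(\<lambda>K. cost (h K) x) \<longlonglongrightarrow> cost \<gamma> x" for x
    unfolding cost_def
  proof (intro tendsto_quad tendsto_add tendsto_const)
    fix i
    have "eventually (\<lambda>K. \<bar>\<gamma> i (Y i x)\<bar> \<le> real K) sequentially"
      using filterlim_real_sequentially by (simp add: filterlim_at_top)
    then have "eventually (\<lambda>K. h K i (Y i x) = \<gamma> i (Y i x)) sequentially"
      by eventually_elim (auto simp: h_def)
    then show "(\<lambda>K. h K i (Y i x)) \<longlonglongrightarrow> \<gamma> i (Y i x)"
      by (rule tendsto_eventually)
  qed
  have "(\<lambda>K. \<integral>\<^sup>+x. ennreal (cost (h K) x) \<partial>\<mu>) \<longlonglongrightarrow> (\<integral>\<^sup>+x. ennreal (cost \<gamma> x) \<partial>\<mu>)"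
  proof (rule nn_integral_dominated_convergence[where w = "\<lambda>x. ennreal (B * ?D x)"])
    show "(\<integral>\<^sup>+x. ennreal (B * ?D x) \<partial>\<mu>) < \<infinity>"
    proof -
      have "0 \<le> B * ?D x" for x using dom[of 0 x] cost_nonneg[of "h 0" x] by linarith
      then show ?thesis using D_int by (simp add: nn_integral_eq_integral)
    qed
    show "(\<lambda>x. ennreal (B * ?D x)) \<in> borel_measurable \<mu>"
      using borel_measurable_integrable[OF D_int] by simp
  qed (use hm dom lim in \<open>auto intro!: ennreal_leI tendsto_ennrealI\<close>)
  from order_tendstoD(2)[OF this a]
  obtain K where "(\<integral>\<^sup>+x. ennreal (cost (h K) x) \<partial>\<mu>) < a"
    by (auto simp: eventually_sequentially)
  then show ?thesis using h_adm[of K] h_bd[of K] by blast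
qed

text \<open>
  The laws \<open>\<nu> n\<close> dominate almost all of \<open>\<mu>\<close> on each set of an exhaustion, which makes integrals of
  nonnegative functions lower semicontinuous in the limit, uniformly enough to apply to the varying
  optimal costs.  Equality of the integrals of \<open>H\<close> excludes that mass escapes to infinity together
  with a quadratic amount of cost, and turns lower bounds for \<open>c * H - cost\<close> into upper bounds for
  the cost.
\<close>

lemma minimal_cost_tendsto:
  fixes \<nu> :: "nat \<Rightarrow> 'e measure" and H :: "'e \<Rightarrow> real"
  assumes \<mu>: "sets \<mu> = sets E" and \<nu>: "eventually (\<lambda>n. sets (\<nu> n) = sets E) F"
    and A: "\<And>k. A' k \<in> sets \<mu>" and inc: "incseq A'" and UN: "(\<Union>k. A' k) = space \<mu>"
    and minor: "\<And>c k. 0 \<le> c \<Longrightarrow> c < 1 \<Longrightarrow> eventually (\<lambda>n. \<forall>g\<in>borel_measurable E.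
        ennreal c * (\<integral>\<^sup>+x. g x * indicator (A' k) x \<partial>\<mu>) \<le> (\<integral>\<^sup>+x. g x \<partial>\<nu> n)) F"
    and H_meas: "H \<in> borel_measurable E" and H_ge: "\<And>x. x \<in> space E \<Longrightarrow> 1 \<le> H x"
    and w_H: "\<And>i x. i < m \<Longrightarrow> x \<in> space E \<Longrightarrow> (w i x)\<^sup>2 \<le> D * H x"
    and H_fin: "(\<integral>\<^sup>+x. ennreal (H x) \<partial>\<mu>) < \<infinity>"
    and H_eq: "eventually (\<lambda>n. (\<integral>\<^sup>+x. ennreal (H x) \<partial>\<nu> n) = (\<integral>\<^sup>+x. ennreal (H x) \<partial>\<mu>)) F"
    and g_adm: "eventually (\<lambda>n. g n \<in> admissible) F"
    and g_min: "eventually (\<lambda>n. \<forall>\<eta>\<in>admissible.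
        (\<integral>\<^sup>+x. ennreal (cost (g n) x) \<partial>\<nu> n) \<le> (\<integral>\<^sup>+x. ennreal (cost \<eta> x) \<partial>\<nu> n)) F"
    and gG: "gG \<in> admissible"
    and gG_min: "\<And>\<eta>. \<eta> \<in> admissible \<Longrightarrow>
        (\<integral>\<^sup>+x. ennreal (cost gG x) \<partial>\<mu>) \<le> (\<integral>\<^sup>+x. ennreal (cost \<eta> x) \<partial>\<mu>)"
  shows "((\<lambda>n. \<integral>\<^sup>+x. ennreal (cost (g n) x) \<partial>\<nu> n) \<longlongrightarrow> (\<integral>\<^sup>+x. ennreal (cost gG x) \<partial>\<mu>)) F"
proof (rule order_tendstoI)
  fix a assume a: "a < (\<integral>\<^sup>+x. ennreal (cost gG x) \<partial>\<mu>)"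
  have "\<exists>k. a < local_value \<mu> (A' k)"
  proof (rule ccontr)
    assume "\<not> (\<exists>k. a < local_value \<mu> (A' k))"
    then have "local_value \<mu> (A' k) \<le> a" for k by (simp add: not_less)
    then obtain \<eta> where "\<eta> \<in> admissible" "(\<integral>\<^sup>+x. ennreal (cost \<eta> x) \<partial>\<mu>) \<le> a"
      using policy_of_local_values[OF \<mu> A inc UN _ less_le_trans[OF a top_greatest, folded infinity_ennreal_def]]
      by blast
    with gG_min[of \<eta>] a show False by (simp add: not_le[symmetric])
  qed
  then obtain k where k: "a < local_value \<mu> (A' k)" ..
  obtain c where c: "0 \<le> c" "c < 1" "a < ennreal c * local_value \<mu> (A' k)"
    by (rule ennreal_less_mult[OF k])
  show "eventually (\<lambda>n. a < (\<integral>\<^sup>+x. ennreal (cost (g n) x) \<partial>\<nu> n)) F"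
    using minor[OF c(1,2), of k] g_adm
  proof eventually_elim
    case (elim n)
    have "(\<lambda>x. ennreal (cost (g n) x)) \<in> borel_measurable E"
      using measurable_cost[OF elim(2)] by simp
    note le = bspec[OF elim(1) this]
    have "local_value \<mu> (A' k) \<le> (\<integral>\<^sup>+x. ennreal (cost (g n) x) * indicator (A' k) x \<partial>\<mu>)"
      unfolding local_value_def by (rule INF_lower[OF elim(2)])
    from mult_left_mono[OF this, of "ennreal c"] le c(3) show ?case
      by (meson less_le_trans order_trans zero_le)
  qed
next
  have space: "space \<mu> = space E" using \<mu> by (rule sets_eq_imp_space_eq)
  fix a assume a: "(\<integral>\<^sup>+x. ennreal (cost gG x) \<partial>\<mu>) < a"
  have w_fin: "(\<integral>\<^sup>+x. ennreal ((w i x)\<^sup>2) \<partial>\<mu>) < \<infinity>" if "i < m" for i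
  proof -
    have "(\<integral>\<^sup>+x. ennreal ((w i x)\<^sup>2) \<partial>\<mu>) \<le> (\<integral>\<^sup>+x. ennreal \<bar>D\<bar> * ennreal (H x) \<partial>\<mu>)"
    proof (rule nn_integral_mono)
      fix x assume "x \<in> space \<mu>"
      then have x: "x \<in> space E" by (simp add: space)
      have "D * H x \<le> \<bar>D\<bar> * H x" using H_ge[OF x] by (intro mult_right_mono) auto
      with w_H[OF that x] have "(w i x)\<^sup>2 \<le> \<bar>D\<bar> * H x" by linarith
      then show "ennreal ((w i x)\<^sup>2) \<le> ennreal \<bar>D\<bar> * ennreal (H x)"
        using H_ge[OF x] by (simp add: ennreal_mult[symmetric] ennreal_leI)
    qed
    also have "\<dots> = ennreal \<bar>D\<bar> * (\<integral>\<^sup>+x. ennreal (H x) \<partial>\<mu>)"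
      using H_meas by (intro nn_integral_cmult) (simp cong: measurable_cong_sets add: \<mu>)
    also have "\<dots> < \<infinity>" using H_fin by (simp add: ennreal_mult_less_top)
    finally show ?thesis .
  qed
  \<comment> \<open>The policy without action shows that the optimal cost is finite.\<close>
  let ?z = "\<lambda>(i::nat) (y::'b). 0::real"
  have B: "0 \<le> (\<Sum>i<m. \<Sum>j<m. \<bar>A i j\<bar>)" by (intro sum_nonneg) auto
  have bounded: "\<exists>c\<ge>0. \<forall>x\<in>space E. cost \<eta> x \<le> c * H x"
    if "\<forall>i<m. \<forall>y. \<bar>\<eta> i y\<bar> \<le> K" for \<eta> K
  proof -
    define c where "c = (\<Sum>i<m. \<Sum>j<m. \<bar>A i j\<bar>) * (\<Sum>i<m. 2 * K\<^sup>2 + 2 * \<bar>D\<bar>)"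
    have "cost \<eta> x \<le> c * H x" if x: "x \<in> space E" for x
    proof -
      have "(\<Sum>i<m. 2 * (\<eta> i (Y i x))\<^sup>2 + 2 * (w i x)\<^sup>2) \<le> (\<Sum>i<m. (2 * K\<^sup>2 + 2 * \<bar>D\<bar>) * H x)"
      proof (rule sum_mono)
        fix i assume "i \<in> {..<m}"
        then have i: "i < m" by simp
        have "\<bar>\<eta> i (Y i x)\<bar> \<le> \<bar>K\<bar>"
          using \<open>\<forall>i<m. \<forall>y. \<bar>\<eta> i y\<bar> \<le> K\<close> i by (meson abs_ge_self order_trans)
        then have "(\<eta> i (Y i x))\<^sup>2 \<le> K\<^sup>2" by (rule abs_le_square_iff[THEN iffD1])
        also have "\<dots> \<le> K\<^sup>2 * H x"
          using mult_left_mono[OF H_ge[OF x], of "K\<^sup>2"] by simp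
        finally have 1: "(\<eta> i (Y i x))\<^sup>2 \<le> K\<^sup>2 * H x" .
        have "D * H x \<le> \<bar>D\<bar> * H x" using H_ge[OF x] by (intro mult_right_mono) auto
        with w_H[OF i x] have "(w i x)\<^sup>2 \<le> \<bar>D\<bar> * H x" by linarith
        with 1 show "2 * (\<eta> i (Y i x))\<^sup>2 + 2 * (w i x)\<^sup>2 \<le> (2 * K\<^sup>2 + 2 * \<bar>D\<bar>) * H x"
          by (simp add: distrib_right)
      qed
      from mult_left_mono[OF this B] cost_le_squares[of \<eta> x] show ?thesis
        unfolding c_def by (simp only: sum_distrib_right[symmetric] mult.assoc)
    qed
    moreover have "0 \<le> c" unfolding c_def by (intro mult_nonneg_nonneg B sum_nonneg) auto
    ultimately show ?thesis by blast
  qed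
  have J_fin: "(\<integral>\<^sup>+x. ennreal (cost gG x) \<partial>\<mu>) < \<infinity>"
  proof -
    obtain c where c: "0 \<le> c" "\<And>x. x \<in> space E \<Longrightarrow> cost ?z x \<le> c * H x"
      using bounded[of ?z 0] by auto
    have "?z \<in> admissible" unfolding admissible_def by simp
    from gG_min[OF this] have "(\<integral>\<^sup>+x. ennreal (cost gG x) \<partial>\<mu>) \<le> (\<integral>\<^sup>+x. ennreal (cost ?z x) \<partial>\<mu>)" .
    also have "\<dots> \<le> (\<integral>\<^sup>+x. ennreal c * ennreal (H x) \<partial>\<mu>)"
    proof (rule nn_integral_mono)
      fix x assume "x \<in> space \<mu>"
      then have x: "x \<in> space E" by (simp add: space)
      show "ennreal (cost ?z x) \<le> ennreal c * ennreal (H x)"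
        using c(2)[OF x] c(1) H_ge[OF x] by (simp add: ennreal_mult[symmetric] ennreal_leI)
    qed
    also have "\<dots> = ennreal c * (\<integral>\<^sup>+x. ennreal (H x) \<partial>\<mu>)"
      using H_meas by (intro nn_integral_cmult) (simp cong: measurable_cong_sets add: \<mu>)
    also have "\<dots> < \<infinity>" using H_fin by (simp add: ennreal_mult_less_top)
    finally show ?thesis .
  qed
  obtain \<eta> K where \<eta>: "\<eta> \<in> admissible" and K: "\<forall>i<m. \<forall>y. \<bar>\<eta> i y\<bar> \<le> K"
    and \<eta>_less: "(\<integral>\<^sup>+x. ennreal (cost \<eta> x) \<partial>\<mu>) < a"
    using bounded_near_optimal[OF \<mu> gG J_fin w_fin a] by blast
  obtain c where c: "0 \<le> c" and c_ge: "\<And>x. x \<in> space E \<Longrightarrow> cost \<eta> x \<le> c * H x"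
    using bounded[OF K] by blast
  define G where "G x = ennreal (c * H x - cost \<eta> x)" for x
  have cost_E: "(\<lambda>x. ennreal (cost \<eta> x)) \<in> borel_measurable E"
    using measurable_cost[OF \<eta>] by simp
  have G_E: "G \<in> borel_measurable E"
    unfolding G_def using measurable_cost[OF \<eta>] H_meas by measurable
  have split: "(\<integral>\<^sup>+x. ennreal (cost \<eta> x) \<partial>\<rho>) + (\<integral>\<^sup>+x. G x \<partial>\<rho>) = ennreal c * (\<integral>\<^sup>+x. ennreal (H x) \<partial>\<rho>)"
    if \<rho>: "sets \<rho> = sets E" for \<rho>
  proof -
    have "(\<integral>\<^sup>+x. ennreal (cost \<eta> x) \<partial>\<rho>) + (\<integral>\<^sup>+x. G x \<partial>\<rho>) = (\<integral>\<^sup>+x. ennreal (cost \<eta> x) + G x \<partial>\<rho>)"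
      using cost_E G_E by (intro nn_integral_add[symmetric]) (simp_all cong: measurable_cong_sets add: \<rho>)
    also have "\<dots> = (\<integral>\<^sup>+x. ennreal c * ennreal (H x) \<partial>\<rho>)"
    proof (rule nn_integral_cong)
      fix x assume "x \<in> space \<rho>"
      then have x: "x \<in> space E" using sets_eq_imp_space_eq[OF \<rho>] by simp
      show "ennreal (cost \<eta> x) + G x = ennreal c * ennreal (H x)"
        unfolding G_def using c c_ge[OF x] H_ge[OF x] cost_nonneg[of \<eta> x]
        by (simp add: ennreal_mult[symmetric] ennreal_plus[symmetric] del: ennreal_plus)
    qed
    also have "\<dots> = ennreal c * (\<integral>\<^sup>+x. ennreal (H x) \<partial>\<rho>)"
      using H_meas by (intro nn_integral_cmult) (simp cong: measurable_cong_sets add: \<rho>)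
    finally show ?thesis .
  qed
  define T where "T = ennreal c * (\<integral>\<^sup>+x. ennreal (H x) \<partial>\<mu>)"
  have T_fin: "T < \<infinity>" unfolding T_def using H_fin by (simp add: ennreal_mult_less_top)
  \<comment> \<open>Lower semicontinuity for the nonnegative gap \<open>G\<close> between \<open>c * H\<close> and the cost.\<close>
  have G_lower: "eventually (\<lambda>n. b < (\<integral>\<^sup>+x. G x \<partial>\<nu> n)) F" if b: "b < (\<integral>\<^sup>+x. G x \<partial>\<mu>)" for b
  proof -
    have "(\<integral>\<^sup>+x. G x \<partial>\<mu>) = (\<integral>\<^sup>+x. (SUP k. G x * indicator (A' k) x) \<partial>\<mu>)"
    proof (rule nn_integral_cong)
      fix x assume x: "x \<in> space \<mu>"
      have "x \<in> (\<Union>k. A' k)" using x by (simp only: UN)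
      then obtain k where k: "x \<in> A' k" by (rule UN_E)
      show "G x = (SUP k. G x * indicator (A' k) x)"
      proof (rule antisym)
        show "G x \<le> (SUP k. G x * indicator (A' k) x)"
          using SUP_upper[of k UNIV "\<lambda>k. G x * indicator (A' k) x"] k by simp
        show "(SUP k. G x * indicator (A' k) x) \<le> G x"
          by (intro SUP_least) (simp split: split_indicator)
      qed
    qed
    also have "\<dots> = (SUP k. \<integral>\<^sup>+x. G x * indicator (A' k) x \<partial>\<mu>)"
    proof (rule nn_integral_monotone_convergence_SUP)
      show "incseq (\<lambda>k x. G x * indicator (A' k) x)"
      proof (intro incseq_SucI le_funI mult_left_mono)
        show "indicator (A' k) x \<le> (indicator (A' (Suc k)) x :: ennreal)" for k x
          using incseqD[OF inc, of k "Suc k"] by (auto split: split_indicator)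
      qed simp
      show "(\<lambda>x. G x * indicator (A' k) x) \<in> borel_measurable \<mu>" for k
        using G_E A[of k] by (simp cong: measurable_cong_sets add: \<mu>)
    qed
    finally obtain k where k: "b < (\<integral>\<^sup>+x. G x * indicator (A' k) x \<partial>\<mu>)"
      using b by (auto simp: less_SUP_iff)
    obtain c' where c': "0 \<le> c'" "c' < 1" "b < ennreal c' * (\<integral>\<^sup>+x. G x * indicator (A' k) x \<partial>\<mu>)"
      by (rule ennreal_less_mult[OF k])
    show ?thesis using minor[OF c'(1,2), of k]
    proof eventually_elim
      case (elim n)
      show ?case by (rule less_le_trans[OF c'(3) bspec[OF elim G_E]])
    qed
  qed
  have "eventually (\<lambda>n. (\<integral>\<^sup>+x. ennreal (cost \<eta> x) \<partial>\<nu> n) < a) F"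
  proof (cases "T < a")
    case True
    show ?thesis using \<nu> H_eq
    proof eventually_elim
      case (elim n)
      have "(\<integral>\<^sup>+x. ennreal (cost \<eta> x) \<partial>\<nu> n) \<le> T"
        unfolding T_def elim(2)[symmetric] split[OF elim(1), symmetric] by simp
      with True show ?case by (rule le_less_trans[rotated])
    qed
  next
    case False
    then have aT: "a \<le> T" by simp
    have T_eq: "(\<integral>\<^sup>+x. ennreal (cost \<eta> x) \<partial>\<mu>) + (\<integral>\<^sup>+x. G x \<partial>\<mu>) = T"
      unfolding T_def by (rule split[OF \<mu>])
    have "T - a < (\<integral>\<^sup>+x. G x \<partial>\<mu>)"
    proof (rule ccontr)
      assume "\<not> T - a < (\<integral>\<^sup>+x. G x \<partial>\<mu>)"
      then have "(\<integral>\<^sup>+x. G x \<partial>\<mu>) + a \<le> T - a + a" by (intro add_right_mono) simp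
      also have "T - a + a = T" using aT by (rule diff_add_cancel_ennreal)
      also have "T = (\<integral>\<^sup>+x. G x \<partial>\<mu>) + (\<integral>\<^sup>+x. ennreal (cost \<eta> x) \<partial>\<mu>)"
        unfolding T_eq[symmetric] by (rule add.commute)
      finally have "(\<integral>\<^sup>+x. G x \<partial>\<mu>) = \<infinity> \<or> a \<le> (\<integral>\<^sup>+x. ennreal (cost \<eta> x) \<partial>\<mu>)"
        by (simp add: ennreal_add_left_cancel_le)
      moreover have "(\<integral>\<^sup>+x. G x \<partial>\<mu>) \<noteq> \<infinity>" using T_fin T_eq by auto
      ultimately show False using \<eta>_less by simp
    qed
    from G_lower[OF this] \<nu> H_eq show ?thesis
    proof eventually_elim
      case (elim n)
      show ?case
      proof (rule ccontr)
        assume "\<not> (\<integral>\<^sup>+x. ennreal (cost \<eta> x) \<partial>\<nu> n) < a"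
        then have "a \<le> (\<integral>\<^sup>+x. ennreal (cost \<eta> x) \<partial>\<nu> n)" by simp
        have "a < \<infinity>" using aT T_fin by (rule le_less_trans)
        then have "a + (T - a) < a + (\<integral>\<^sup>+x. G x \<partial>\<nu> n)"
          using elim(1) unfolding ennreal_add_left_cancel_less by simp
        also have "\<dots> \<le> (\<integral>\<^sup>+x. ennreal (cost \<eta> x) \<partial>\<nu> n) + (\<integral>\<^sup>+x. G x \<partial>\<nu> n)"
          by (rule add_right_mono) fact
        also have "\<dots> = T" unfolding T_def elim(3)[symmetric] by (rule split[OF elim(2)])
        also have "T = a + (T - a)" 
          using diff_add_cancel_ennreal[OF aT] unfolding add.commute[of "T - a"] by (rule sym)
        finally show False by simp
      qed
    qed
  qed
  with g_min show "eventually (\<lambda>n. (\<integral>\<^sup>+x. ennreal (cost (g n) x) \<partial>\<nu> n) < a) F"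
    by eventually_elim (use \<eta> in \<open>auto intro: le_less_trans\<close>)
qed

end

section \<open>The team cost as a coercive quadratic form\<close>

lemma pos_def_sym:
  assumes "pos_def m Q" "a \<in> carrier_vec m" "b \<in> carrier_vec m"
  shows "a \<bullet> (Q *\<^sub>v b) = b \<bullet> (Q *\<^sub>v a)"
proof -
  have Q: "Q \<in> carrier_mat m m" "transpose_mat Q = Q" using assms(1) by (auto simp: pos_def_def)
  have "a \<bullet> (Q *\<^sub>v b) = (Q *\<^sub>v a) \<bullet> b"
    using transpose_vec_mult_scalar[OF Q(1) assms(3,2)] Q(2) by simp
  also have "\<dots> = b \<bullet> (Q *\<^sub>v a)"
    by (rule comm_scalar_prod) (use Q assms in auto)
  finally show ?thesis .
qed

lemma pos_def_nonneg:
  assumes "pos_def m Q" "v \<in> carrier_vec m"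
  shows "0 \<le> v \<bullet> (Q *\<^sub>v v)"
proof (cases "v = 0\<^sub>v m")
  case True
  moreover have "Q *\<^sub>v v \<in> carrier_vec m" using assms by (auto simp: pos_def_def)
  ultimately show ?thesis by simp
next
  case False
  then show ?thesis using assms by (auto simp: pos_def_def intro: less_imp_le)
qed

lemma pos_def_expand:
  assumes Q: "pos_def m Q" and a: "a \<in> carrier_vec m" and b: "b \<in> carrier_vec m"
  shows "(a + b) \<bullet> (Q *\<^sub>v (a + b)) = a \<bullet> (Q *\<^sub>v a) + 2 * (a \<bullet> (Q *\<^sub>v b)) + b \<bullet> (Q *\<^sub>v b)"
proof -
  have Qc: "Q \<in> carrier_mat m m" using Q by (simp add: pos_def_def)
  have c: "Q *\<^sub>v a \<in> carrier_vec m" "Q *\<^sub>v b \<in> carrier_vec m" using Qc a b by auto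
  have "(a + b) \<bullet> (Q *\<^sub>v (a + b)) = (a + b) \<bullet> (Q *\<^sub>v a + Q *\<^sub>v b)"
    by (simp only: mult_add_distrib_mat_vec[OF Qc a b])
  also have "\<dots> = a \<bullet> (Q *\<^sub>v a) + a \<bullet> (Q *\<^sub>v b) + (b \<bullet> (Q *\<^sub>v a) + b \<bullet> (Q *\<^sub>v b))"
    using a b c by (simp add: add_scalar_prod_distrib[of _ m] scalar_prod_add_distrib[of _ m])
  finally show ?thesis using pos_def_sym[OF Q b a] by simp
qed

lemma team_cost_complete_square:
  assumes Q: "pos_def m Q" and S: "S \<in> carrier_mat m n"
    and u: "u \<in> carrier_vec m" and x: "x \<in> carrier_vec n"
    and w_eq: "w = the (mat_inverse Q) *\<^sub>v (S *\<^sub>v x)"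
  shows "team_cost Q S u x = 1/2 * ((u + w) \<bullet> (Q *\<^sub>v (u + w)))"
proof -
  have Qc: "Q \<in> carrier_mat m m" using Q by (simp add: pos_def_def)
  have P: "the (mat_inverse Q) \<in> carrier_mat m m" by (rule pos_def_inverse(3)[OF Q])
  have y: "S *\<^sub>v x \<in> carrier_vec m" using S x by simp
  have w: "w \<in> carrier_vec m" unfolding w_eq using P y by simp
  have Qw: "Q *\<^sub>v w = S *\<^sub>v x"
    unfolding w_eq assoc_mult_mat_vec[OF Qc P y, symmetric] pos_def_inverse(1)[OF Q]
    using y by simp
  have "x \<bullet> (transpose_mat S *\<^sub>v w) = (transpose_mat S *\<^sub>v w) \<bullet> x"
    by (rule comm_scalar_prod) (use S x w in auto)
  also have "\<dots> = w \<bullet> (S *\<^sub>v x)"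
    by (rule transpose_vec_mult_scalar[OF S x w])
  finally have "x \<bullet> (transpose_mat S *\<^sub>v w) = w \<bullet> (Q *\<^sub>v w)"
    unfolding Qw .
  moreover have "team_cost Q S u x
      = 1/2 * (u \<bullet> (Q *\<^sub>v u)) + u \<bullet> (Q *\<^sub>v w) + 1/2 * (x \<bullet> (transpose_mat S *\<^sub>v w))"
    unfolding Qw unfolding w_eq team_cost_def ..
  ultimately show ?thesis
    unfolding pos_def_expand[OF Q u w] by simp
qed

lemma quad_eq_scalar_prod:
  assumes "Q \<in> carrier_mat m m" "v \<in> carrier_vec m"
  shows "1/2 * (v \<bullet> (Q *\<^sub>v v)) = quad m (\<lambda>i j. Q $$ (i, j) / 2) (\<lambda>i. v $ i)"
  using assms unfolding quad_def scalar_prod_def mult_mat_vec_def row_def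
  by (auto simp: sum_distrib_left atLeast0LessThan intro!: sum.cong)

lemma quad_of_vec:
  assumes "Q \<in> carrier_mat m m"
  shows "quad m (\<lambda>i j. Q $$ (i, j) / 2) v
    = 1/2 * (Matrix.vec m v \<bullet> (Q *\<^sub>v Matrix.vec m v))"
  by (subst quad_eq_scalar_prod[OF assms]) (auto intro: quad_cong)

text \<open>
  With \<open>P\<close> the inverse of \<open>Q\<close> and \<open>p = P e\<^sub>i\<close>, the coordinate \<open>v\<^sub>i\<close> is the \<open>Q\<close>-inner product of \<open>p\<close> and \<open>v\<close>, so
  the bound is the Cauchy-Schwarz inequality for \<open>Q\<close>, with \<open>P\<^sub>i\<^sub>i\<close> as the square of the \<open>Q\<close>-norm of \<open>p\<close>.
\<close>

lemma pos_def_coercive: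
  assumes Q: "pos_def m Q"
  shows "\<exists>\<kappa>>0. \<forall>v. \<forall>i<m. (v i)\<^sup>2 \<le> \<kappa> * quad m (\<lambda>i j. Q $$ (i, j) / 2) v"
proof -
  define P where "P = the (mat_inverse Q)"
  have Qc: "Q \<in> carrier_mat m m" using Q by (simp add: pos_def_def)
  have P: "P \<in> carrier_mat m m" unfolding P_def by (rule pos_def_inverse(3)[OF Q])
  \<comment> \<open>One constant for all coordinates; the summand 1 avoids showing that \<open>P\<^sub>i\<^sub>i\<close> is positive.\<close>
  define c where "c = 1 + (\<Sum>i<m. \<bar>P $$ (i, i)\<bar>)"
  have c1: "1 \<le> c" unfolding c_def by (simp add: sum_nonneg)
  have "(v $ i)\<^sup>2 \<le> c * (v \<bullet> (Q *\<^sub>v v))" if i: "i < m" and v: "v \<in> carrier_vec m" for v i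
  proof -
    define p where "p = P *\<^sub>v unit_vec m i"
    have p: "p \<in> carrier_vec m" unfolding p_def using P by simp
    have Qp: "Q *\<^sub>v p = unit_vec m i"
      unfolding p_def assoc_mult_mat_vec[OF Qc P unit_vec_carrier, symmetric]
      unfolding P_def pos_def_inverse(1)[OF Q] by simp
    have p_i: "p $ i = P $$ (i, i)"
      unfolding p_def using P i by (simp add: mult_mat_vec_def)
    have "P $$ (i, i) \<le> c"
    proof -
      have "\<bar>P $$ (i, i)\<bar> \<le> (\<Sum>i<m. \<bar>P $$ (i, i)\<bar>)" using i by (intro member_le_sum) auto
      then show ?thesis unfolding c_def by linarith
    qed
    \<comment> \<open>The minimizer of the upper bound \<open>v\<^sup>T Q v + 2 t v\<^sub>i + t\<^sup>2 c\<close> for the form at \<open>v + t p\<close>.\<close>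
    define t where "t = - (v $ i / c)"
    have tp: "t \<cdot>\<^sub>v p \<in> carrier_vec m" using p by simp
    have Qtp: "Q *\<^sub>v (t \<cdot>\<^sub>v p) = t \<cdot>\<^sub>v unit_vec m i"
      using mult_mat_vec[OF Qc p] Qp by simp
    have "0 \<le> (v + t \<cdot>\<^sub>v p) \<bullet> (Q *\<^sub>v (v + t \<cdot>\<^sub>v p))"
      by (rule pos_def_nonneg[OF Q]) (use v tp in simp)
    also have "\<dots> = v \<bullet> (Q *\<^sub>v v) + 2 * (t * v $ i) + t\<^sup>2 * P $$ (i, i)"
      unfolding pos_def_expand[OF Q v tp] Qtp
      using v p i by (simp add: scalar_prod_right_unit p_i power2_eq_square)
    also have "\<dots> \<le> v \<bullet> (Q *\<^sub>v v) + 2 * (t * v $ i) + t\<^sup>2 * c"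
      using \<open>P $$ (i, i) \<le> c\<close> by (simp add: mult_left_mono)
    also have "\<dots> = v \<bullet> (Q *\<^sub>v v) - (v $ i)\<^sup>2 / c"
      unfolding t_def using c1 by (simp add: power2_eq_square field_simps)
    finally show ?thesis using c1 by (simp add: field_simps)
  qed
  note le = this
  have "(v i)\<^sup>2 \<le> (2 * c) * quad m (\<lambda>i j. Q $$ (i, j) / 2) v" if "i < m" for v i
    using le[OF that vec_carrier, of v] that by (simp add: quad_of_vec[OF Qc])
  then show ?thesis using c1 by (intro exI[of _ "2 * c"]) auto
qed

lemma quad_pos_def_nonneg:
  assumes "pos_def m Q"
  shows "0 \<le> quad m (\<lambda>i j. Q $$ (i, j) / 2) v"
  using quad_of_vec[of Q m v] pos_def_nonneg[OF assms, of "Matrix.vec m v"] assms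
  by (simp add: pos_def_def)

lemma measurable_mult_mat_vec:
  assumes "B \<in> carrier_mat r c"
  shows "(\<lambda>x. B *\<^sub>v x) \<in> measurable (borel_vec c) (borel_vec r)"
proof -
  have "(\<lambda>x. Matrix.vec r (\<lambda>i. \<Sum>j<c. B $$ (i, j) * x $ j)) \<in> measurable (borel_vec c) (borel_vec r)"
    by (intro measurable_vecI borel_measurable_sum borel_measurable_times borel_measurable_const
        measurable_vec_index) auto
  moreover have "B *\<^sub>v x = Matrix.vec r (\<lambda>i. \<Sum>j<c. B $$ (i, j) * x $ j)"
    if "x \<in> space (borel_vec c)" for x
    using that assms
    by (intro eq_vecI) (auto simp: space_borel_vec scalar_prod_def atLeast0LessThan intro!: sum.cong)
  ultimately show ?thesis by (simp cong: measurable_cong)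
qed

lemma norm_vec_eq: "norm_vec x = sqrt (\<Sum>j<dim_vec x. (x $ j)\<^sup>2)"
  unfolding norm_vec_def scalar_prod_def by (simp add: power2_eq_square atLeast0LessThan)

lemma mult_mat_vec_square_le:
  fixes B :: "real mat"
  assumes B: "B \<in> carrier_mat r c" and x: "x \<in> carrier_vec c" and i: "i < r"
  shows "((B *\<^sub>v x) $ i)\<^sup>2 \<le> (\<Sum>i<r. \<Sum>j<c. (B $$ (i, j))\<^sup>2) * (\<Sum>j<c. (x $ j)\<^sup>2)"
proof -
  have "((B *\<^sub>v x) $ i)\<^sup>2 = (\<Sum>j<c. B $$ (i, j) * x $ j)\<^sup>2"
    using assms by (simp add: scalar_prod_def atLeast0LessThan)
  also have "\<dots> \<le> (\<Sum>j<c. (B $$ (i, j))\<^sup>2) * (\<Sum>j<c. (x $ j)\<^sup>2)"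
    by (rule Cauchy_Schwarz_ineq_sum)
  also have "\<dots> \<le> (\<Sum>i<r. \<Sum>j<c. (B $$ (i, j))\<^sup>2) * (\<Sum>j<c. (x $ j)\<^sup>2)"
    using i by (intro mult_right_mono member_le_sum[of i "{..<r}" "\<lambda>i. \<Sum>j<c. (B $$ (i, j))\<^sup>2"])
      (auto intro: sum_nonneg)
  finally show ?thesis .
qed

section \<open>Gaussian and isotropic laws\<close>

lemma nn_integral_lborel_vec:
  assumes "g \<in> borel_measurable (lborel_vec n)"
  shows "(\<integral>\<^sup>+x. g x \<partial>lborel_vec n) = (\<integral>\<^sup>+f. g (Matrix.vec n f) \<partial>(\<Pi>\<^sub>M i\<in>{..<n}. lborel))"
proof -
  have "space (\<Pi>\<^sub>M i\<in>{..<n}. (lborel :: real measure)) = space (\<Pi>\<^sub>M i\<in>{..<n}. borel)"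
    by (simp add: space_PiM)
  then have "inj_on (Matrix.vec n) (space (\<Pi>\<^sub>M i\<in>{..<n}. (lborel :: real measure)))"
    using inj_on_vec by simp
  then show ?thesis
    using assms unfolding lborel_vec_def by (rule nn_integral_embed_measure')
qed

lemma measurable_lborel_vec_iff: "measurable (lborel_vec n) = measurable (borel_vec n)"
  by (intro ext measurable_cong_sets sets_lborel_vec refl)

lemma measurable_to_lborel_vec: "measurable M (lborel_vec n) = measurable M (borel_vec n)"
  by (intro measurable_cong_sets sets_lborel_vec refl)

lemma std_normal_vec_density_measurable:
  "std_normal_vec_density l \<in> borel_measurable (borel_vec l)"
  unfolding std_normal_vec_density_def[abs_def]
  by (intro borel_measurable_prod measurable_compose[OF measurable_vec_index borel_measurable_normal_density]) simp

lemma std_normal_vec_density_pos: "0 < std_normal_vec_density l x"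
  unfolding std_normal_vec_density_def by (intro prod_pos) (simp add: normal_density_pos)

lemma nn_integral_std_normal: "(\<integral>\<^sup>+t. ennreal (std_normal_density t) \<partial>lborel) = 1"
  using std_normal_moment_even[of 0]
  by (auto simp: has_bochner_integral_iff nn_integral_eq_integral)

lemma nn_integral_std_normal_square:
  "(\<integral>\<^sup>+t. ennreal (std_normal_density t * t\<^sup>2) \<partial>lborel) = 1"
  using std_normal_moment_even[of 1]
  by (auto simp: has_bochner_integral_iff nn_integral_eq_integral fact_numeral)

lemma gaussian_second_moment:
  assumes j: "j < l"
  shows "(\<integral>\<^sup>+x. ennreal (std_normal_vec_density l x * (x $ j)\<^sup>2) \<partial>lborel_vec l) = 1"
proof -
  interpret product_sigma_finite "\<lambda>_::nat. lborel :: real measure" ..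
  have "(\<integral>\<^sup>+x. ennreal (std_normal_vec_density l x * (x $ j)\<^sup>2) \<partial>lborel_vec l)
      = (\<integral>\<^sup>+f. ennreal (std_normal_vec_density l (Matrix.vec l f) * (Matrix.vec l f $ j)\<^sup>2) \<partial>(\<Pi>\<^sub>M i\<in>{..<l}. lborel))"
    using std_normal_vec_density_measurable[of l] measurable_vec_index[OF j]
    by (intro nn_integral_lborel_vec) (simp add: measurable_lborel_vec_iff)
  also have "\<dots> = (\<integral>\<^sup>+f. (\<Prod>i\<in>{..<l}. ennreal (if i = j then std_normal_density (f i) * (f i)\<^sup>2 else std_normal_density (f i))) \<partial>(\<Pi>\<^sub>M i\<in>{..<l}. lborel))"
  proof (rule nn_integral_cong)
    fix f :: "nat \<Rightarrow> real"
    have "std_normal_vec_density l (Matrix.vec l f) * (Matrix.vec l f $ j)\<^sup>2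
        = (\<Prod>i<l. std_normal_density (f i)) * (\<Prod>i<l. if i = j then (f i)\<^sup>2 else 1)"
      using j by (simp add: std_normal_vec_density_def)
    also have "\<dots> = (\<Prod>i<l. if i = j then std_normal_density (f i) * (f i)\<^sup>2 else std_normal_density (f i))"
      unfolding prod.distrib[symmetric] by (intro prod.cong) auto
    finally show "ennreal (std_normal_vec_density l (Matrix.vec l f) * (Matrix.vec l f $ j)\<^sup>2)
        = (\<Prod>i\<in>{..<l}. ennreal (if i = j then std_normal_density (f i) * (f i)\<^sup>2 else std_normal_density (f i)))"
      by (subst prod_ennreal) auto
  qed
  also have "\<dots> = (\<Prod>i\<in>{..<l}. \<integral>\<^sup>+t. ennreal (if i = j then std_normal_density t * t\<^sup>2 else std_normal_density t) \<partial>lborel)"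
    by (rule product_nn_integral_prod) auto
  also have "\<dots> = 1"
  proof (intro prod.neutral ballI)
    fix i
    show "(\<integral>\<^sup>+t. ennreal (if i = j then std_normal_density t * t\<^sup>2 else std_normal_density t) \<partial>lborel) = 1"
      by (cases "i = j") (simp_all only: if_True if_False refl simp_thms nn_integral_std_normal nn_integral_std_normal_square)
  qed
  finally show ?thesis .
qed

text \<open>
  The second moment of the \<open>j\<close>-th coordinate is the squared norm of the \<open>j\<close>-th column of \<open>R\<close>.  It equals
  the Gaussian one exactly, not just in the limit; the density bound alone would not exclude a
  contribution from far away.
\<close>

lemma isotropic_projection_second_moment:
  assumes iso: "isotropic M n X" and R: "R \<in> stiefel n l" and j: "j < l"
  shows "(\<integral>\<^sup>+\<omega>. ennreal (((transpose_mat R *\<^sub>v X \<omega>) $ j)\<^sup>2) \<partial>M) = 1"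
proof -
  have Rc: "R \<in> carrier_mat n l" and RR: "transpose_mat R * R = 1\<^sub>m l"
    using R by (auto simp: stiefel_def)
  have Xm: "X \<in> measurable M (borel_vec n)" using iso by (simp add: isotropic_def)
  have mean: "(\<integral>\<omega>. X \<omega> $ i \<partial>M) = 0" if "i < n" for i
    using iso that by (simp add: isotropic_def)
  have int: "integrable M (\<lambda>\<omega>. X \<omega> $ i * X \<omega> $ k)"
    and cov: "(\<integral>\<omega>. X \<omega> $ i * X \<omega> $ k \<partial>M) = (if i = k then 1 else 0)"
    if "i < n" "k < n" for i k
    using iso that mean by (auto simp: isotropic_def)
  have X: "X \<omega> \<in> carrier_vec n" if "\<omega> \<in> space M" for \<omega>
    using measurable_space[OF Xm that] by (simp add: space_borel_vec)
  let ?s = "\<lambda>\<omega>. \<Sum>i<n. \<Sum>k<n. (R $$ (i, j) * R $$ (k, j)) * (X \<omega> $ i * X \<omega> $ k)"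
  have sq: "((transpose_mat R *\<^sub>v X \<omega>) $ j)\<^sup>2 = ?s \<omega>" if "\<omega> \<in> space M" for \<omega>
  proof -
    have "(transpose_mat R *\<^sub>v X \<omega>) $ j = (\<Sum>i<n. R $$ (i, j) * X \<omega> $ i)"
      using Rc j X[OF that] by (simp add: scalar_prod_def atLeast0LessThan)
    then show ?thesis
      by (simp add: power2_eq_square sum_product mult_ac)
  qed
  have "has_bochner_integral M (\<lambda>\<omega>. X \<omega> $ i * X \<omega> $ k) (if i = k then 1 else 0)"
    if "i < n" "k < n" for i k
    using int[OF that] cov[OF that] by (simp add: has_bochner_integral_iff)
  then have s_int: "has_bochner_integral M ?s
      (\<Sum>i<n. \<Sum>k<n. (R $$ (i, j) * R $$ (k, j)) * (if i = k then 1 else 0))"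
    by (intro has_bochner_integral_sum has_bochner_integral_mult_right) simp_all
  have "(\<Sum>i<n. \<Sum>k<n. (R $$ (i, j) * R $$ (k, j)) * (if i = k then 1 else 0))
      = (\<Sum>i<n. R $$ (i, j) * R $$ (i, j))"
    by (intro sum.cong refl) (simp add: if_distrib cong: if_cong)
  also have "\<dots> = (transpose_mat R * R) $$ (j, j)"
    using Rc j by (simp add: scalar_prod_def atLeast0LessThan)
  also have "\<dots> = 1" using RR j by simp
  finally have "integrable M ?s" "(\<integral>\<omega>. ?s \<omega> \<partial>M) = 1"
    using s_int by (simp_all add: has_bochner_integral_iff)
  moreover have "(\<integral>\<^sup>+\<omega>. ennreal (((transpose_mat R *\<^sub>v X \<omega>) $ j)\<^sup>2) \<partial>M) = (\<integral>\<^sup>+\<omega>. ennreal (?s \<omega>) \<partial>M)"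
    by (intro nn_integral_cong) (simp only: sq)
  moreover have "AE \<omega> in M. 0 \<le> ?s \<omega>"
    by (intro AE_I2) (simp only: sq[symmetric] zero_le_power2)
  ultimately show ?thesis
    using nn_integral_eq_integral[of M ?s] by simp
qed

lemma isotropic_distr:
  assumes "isotropic M n X"
  shows "isotropic (distr M (borel_vec n) X) n (\<lambda>x. x)"
proof -
  have X: "X \<in> measurable M (borel_vec n)" using assms by (simp add: isotropic_def)
  have m: "(\<lambda>x. x $ i) \<in> borel_measurable (borel_vec n)" if "i < n" for i
    by (rule measurable_vec_index[OF that])
  have mean: "(\<integral>x. x $ i \<partial>distr M (borel_vec n) X) = (\<integral>\<omega>. X \<omega> $ i \<partial>M)" if "i < n" for i
    by (rule integral_distr[OF X m[OF that]])
  have m2: "(\<lambda>x. (x $ i - c) * (x $ j - d)) \<in> borel_measurable (borel_vec n)" if "i < n" "j < n" for i j c d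
    using m[OF that(1)] m[OF that(2)] by measurable
  have m3: "(\<lambda>x. x $ i * x $ j) \<in> borel_measurable (borel_vec n)" if "i < n" "j < n" for i j
    using m2[OF that, of 0 0] by simp
  show ?thesis
    using assms unfolding isotropic_def
    by (auto simp: integrable_distr_eq[OF X m3] integral_distr[OF X m3] integrable_distr_eq[OF X m] integrable_distr_eq[OF X m2]
        integral_distr[OF X m] integral_distr[OF X m2] mean)
qed

lemma log_concave_density_distr:
  assumes X: "X \<in> measurable M (borel_vec n)" and "has_log_concave_density M n X"
  shows "has_log_concave_density (distr M (borel_vec n) X) n (\<lambda>x. x)"
proof -
  have [measurable]: "X \<in> measurable M (lborel_vec n)" "X \<in> measurable M (borel_vec n)"
    "(\<lambda>x. x) \<in> measurable (borel_vec n) (lborel_vec n)"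
    using X by (auto simp: measurable_to_lborel_vec)
  have "distr (distr M (borel_vec n) X) (lborel_vec n) (\<lambda>x. x) = distr M (lborel_vec n) X"
    by (subst distr_distr) (auto simp: comp_def)
  then show ?thesis
    using assms(2) unfolding has_log_concave_density_def distributed_def by auto
qed

text \<open>
  The conclusion of the theorem of Eldan and Klartag for a single law, with the rates of
  approximation as parameters.
\<close>

definition near_gaussian :: "real \<Rightarrow> real \<Rightarrow> nat \<Rightarrow> real vec measure \<Rightarrow> bool" where
  "near_gaussian \<epsilon> r l \<nu> \<longleftrightarrow> (\<exists>f. (\<forall>x. 0 \<le> f x) \<and>
     distributed \<nu> (lborel_vec l) (\<lambda>x. x) (\<lambda>x. ennreal (f x)) \<and>
     (\<forall>x\<in>carrier_vec l. norm_vec x \<le> r \<longrightarrow> \<bar>f x / std_normal_vec_density l x - 1\<bar> \<le> \<epsilon>))"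

text \<open>
  Inside the ball the density bound gives \<open>f \<ge> c \<phi>\<close>; outside it the integrand \<open>g\<close>, about whose growth
  nothing is known, is simply discarded on the Gaussian side.
\<close>

lemma near_gaussian_minorization:
  assumes \<nu>: "near_gaussian \<epsilon> r l \<nu>"
    and \<mu>: "distributed \<mu> (lborel_vec l) (\<lambda>x. x) (\<lambda>x. ennreal (std_normal_vec_density l x))"
    and c: "0 \<le> c" "c \<le> 1 - \<epsilon>" and k: "k \<le> r"
    and g: "g \<in> borel_measurable (borel_vec l)"
    and A: "A' = {x \<in> carrier_vec l. norm_vec x \<le> k}" "A' \<in> sets (borel_vec l)"
  shows "ennreal c * (\<integral>\<^sup>+x. g x * indicator A' x \<partial>\<mu>) \<le> (\<integral>\<^sup>+x. g x \<partial>\<nu>)"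
proof -
  obtain f where f0: "\<And>x. 0 \<le> f x"
    and f: "distributed \<nu> (lborel_vec l) (\<lambda>x. x) (\<lambda>x. ennreal (f x))"
    and f_near: "\<And>x. x \<in> carrier_vec l \<Longrightarrow> norm_vec x \<le> r \<Longrightarrow>
      \<bar>f x / std_normal_vec_density l x - 1\<bar> \<le> \<epsilon>"
    using \<nu> unfolding near_gaussian_def by blast
  let ?\<phi> = "std_normal_vec_density l"
  have g': "g \<in> borel_measurable (lborel_vec l)" using g by (simp add: measurable_lborel_vec_iff)
  have gA: "(\<lambda>x. g x * indicator A' x) \<in> borel_measurable (lborel_vec l)"
    using g A(2) by (simp add: measurable_lborel_vec_iff)
  have \<phi>m: "?\<phi> \<in> borel_measurable (lborel_vec l)"
    using std_normal_vec_density_measurable by (simp add: measurable_lborel_vec_iff)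
  have "ennreal c * (\<integral>\<^sup>+x. g x * indicator A' x \<partial>\<mu>)
      = ennreal c * (\<integral>\<^sup>+x. ennreal (?\<phi> x) * (g x * indicator A' x) \<partial>lborel_vec l)"
    by (simp only: distributed_nn_integral[OF \<mu> gA])
  also have "\<dots> = (\<integral>\<^sup>+x. ennreal c * (ennreal (?\<phi> x) * (g x * indicator A' x)) \<partial>lborel_vec l)"
    using gA \<phi>m by (intro nn_integral_cmult[symmetric]) measurable
  also have "\<dots> \<le> (\<integral>\<^sup>+x. ennreal (f x) * g x \<partial>lborel_vec l)"
  proof (rule nn_integral_mono)
    fix x
    show "ennreal c * (ennreal (?\<phi> x) * (g x * indicator A' x)) \<le> ennreal (f x) * g x"
    proof (cases "x \<in> A'")
      case True
      then have "\<bar>f x / ?\<phi> x - 1\<bar> \<le> \<epsilon>" using k A by (intro f_near) auto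
      then have "c \<le> f x / ?\<phi> x" using c by linarith
      then have "c * ?\<phi> x \<le> f x"
        using std_normal_vec_density_pos[of l x] by (simp add: field_simps)
      then have "ennreal c * ennreal (?\<phi> x) \<le> ennreal (f x)"
        using c(1) std_normal_vec_density_pos[of l x]
        by (simp add: ennreal_mult[symmetric] ennreal_leI)
      from mult_right_mono[OF this, of "g x"] True show ?thesis
        by (simp add: mult.assoc)
    qed simp
  qed
  also have "\<dots> = (\<integral>\<^sup>+x. g x \<partial>\<nu>)" by (rule distributed_nn_integral[OF f g'])
  finally show ?thesis .
qed

lemma unit_second_moments_integral:
  assumes \<rho>: "sets \<rho> = sets (borel_vec l)" and prob: "prob_space \<rho>"
    and sec: "\<And>j. j < l \<Longrightarrow> (\<integral>\<^sup>+x. ennreal ((x $ j)\<^sup>2) \<partial>\<rho>) = 1"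
  shows "(\<integral>\<^sup>+x. ennreal (1 + (\<Sum>j<l. (x $ j)\<^sup>2)) \<partial>\<rho>) = 1 + of_nat l"
proof -
  have m: "(\<lambda>x. x $ j) \<in> borel_measurable \<rho>" if "j < l" for j
    using measurable_vec_index[OF that] by (simp cong: measurable_cong_sets add: \<rho>)
  have "(\<integral>\<^sup>+x. ennreal (1 + (\<Sum>j<l. (x $ j)\<^sup>2)) \<partial>\<rho>)
      = (\<integral>\<^sup>+x. 1 + (\<Sum>j<l. ennreal ((x $ j)\<^sup>2)) \<partial>\<rho>)"
    by (intro nn_integral_cong) (simp add: sum_nonneg)
  also have "\<dots> = (\<integral>\<^sup>+x. 1 \<partial>\<rho>) + (\<integral>\<^sup>+x. (\<Sum>j<l. ennreal ((x $ j)\<^sup>2)) \<partial>\<rho>)"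
    using m by (intro nn_integral_add) auto
  also have "(\<integral>\<^sup>+x. (\<Sum>j<l. ennreal ((x $ j)\<^sup>2)) \<partial>\<rho>) = (\<Sum>j<l. \<integral>\<^sup>+x. ennreal ((x $ j)\<^sup>2) \<partial>\<rho>)"
    using m by (intro nn_integral_sum) auto
  also have "\<dots> = of_nat l" by (simp add: sec)
  also have "(\<integral>\<^sup>+x. 1 \<partial>\<rho>) = 1"
    using prob by (simp add: prob_space.emeasure_space_1)
  finally show ?thesis .
qed

lemma norm_ball_sets: "{x \<in> carrier_vec l. norm_vec x \<le> k} \<in> sets (borel_vec l)"
proof -
  have "(\<lambda>x. sqrt (\<Sum>j<l. (x $ j)\<^sup>2)) \<in> borel_measurable (borel_vec l)"
    using measurable_vec_index
    by (intro measurable_compose[OF _ borel_measurable_sqrt] borel_measurable_sum borel_measurable_power) auto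
  then have "{x \<in> space (borel_vec l). sqrt (\<Sum>j<l. (x $ j)\<^sup>2) \<le> k} \<in> sets (borel_vec l)"
    by measurable
  also have "{x \<in> space (borel_vec l). sqrt (\<Sum>j<l. (x $ j)\<^sup>2) \<le> k} = {x \<in> carrier_vec l. norm_vec x \<le> k}"
    by (auto simp: space_borel_vec norm_vec_eq)
  finally show ?thesis .
qed

lemma near_gaussian_of_projection:
  assumes \<xi>: "\<xi> \<in> measurable M (borel_vec n)" and R: "R \<in> carrier_mat n l"
    and ek: "\<exists>f. (\<forall>x. 0 \<le> f x) \<and>
      distributed (distr M (borel_vec n) \<xi>) (lborel_vec l) (\<lambda>x. transpose_mat R *\<^sub>v x) (\<lambda>x. ennreal (f x)) \<and>
      (\<forall>x\<in>carrier_vec l. norm_vec x \<le> r \<longrightarrow> \<bar>f x / std_normal_vec_density l x - 1\<bar> \<le> \<epsilon>)"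
  shows "near_gaussian \<epsilon> r l (distr M (borel_vec l) (\<lambda>\<omega>. transpose_mat R *\<^sub>v \<xi> \<omega>))"
proof -
  let ?\<nu> = "distr M (borel_vec l) (\<lambda>\<omega>. transpose_mat R *\<^sub>v \<xi> \<omega>)"
  have Rm: "(\<lambda>x. transpose_mat R *\<^sub>v x) \<in> measurable (borel_vec n) (borel_vec l)"
    by (rule measurable_mult_mat_vec) (use R in simp)
  have [measurable]: "\<xi> \<in> measurable M (borel_vec n)"
    "(\<lambda>x. transpose_mat R *\<^sub>v x) \<in> measurable (borel_vec n) (lborel_vec l)"
    "(\<lambda>\<omega>. transpose_mat R *\<^sub>v \<xi> \<omega>) \<in> measurable M (borel_vec l)"
    "(\<lambda>x. x) \<in> measurable (borel_vec l) (lborel_vec l)"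
    using \<xi> Rm by (auto simp: measurable_to_lborel_vec intro: measurable_compose)
  have "distr ?\<nu> (lborel_vec l) (\<lambda>x. x)
      = distr (distr M (borel_vec n) \<xi>) (lborel_vec l) (\<lambda>x. transpose_mat R *\<^sub>v x)"
    by (subst (1 2) distr_distr) (auto simp: comp_def)
  moreover have "(\<lambda>x. x) \<in> measurable ?\<nu> (lborel_vec l)" by simp
  ultimately show ?thesis
    using ek unfolding near_gaussian_def distributed_def by metis
qed

section \<open>Reduction to the projected random vector\<close>

lemma W_zero_carrier: "W \<in> carrier_mat l' l \<Longrightarrow> W_zero m W \<in> carrier_mat m l"
  by (auto simp: W_zero_def rows_from_def)

lemma W_obs_carrier: "W \<in> carrier_mat l' l \<Longrightarrow> W_obs m ls W i \<in> carrier_mat (ls i) l"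
  by (auto simp: W_obs_def rows_from_def)

lemma expected_cost_no_players:
  assumes "pos_def 0 Q" "dim_row S = 0"
  shows "expected_cost M 0 Q S H \<gamma> X = 0"
proof -
  have "the (mat_inverse Q) \<in> carrier_mat 0 0" "Q \<in> carrier_mat 0 0"
    using pos_def_inverse(3)[OF assms(1)] assms(1) by (auto simp: pos_def_def)
  then have "team_cost Q S (Matrix.vec 0 u) x = 0" for u x
    using assms(2) by (simp add: team_cost_def scalar_prod_def mult_mat_vec_def)
  then show ?thesis by (simp add: expected_cost_def)
qed

text \<open>
  The constant \<open>\<kappa>\<close> comes from \<open>pos_def_coercive\<close>; carrying it as a parameter lets the team problem
  be an instance of the abstract quadratic team.
\<close>

locale static_team =
  fixes m l :: nat and ls :: "nat \<Rightarrow> nat" and Q W :: "real mat" and \<kappa> :: real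
  assumes Q: "pos_def m Q" and W: "W \<in> carrier_mat l l"
    and \<kappa>: "0 < \<kappa>" "\<And>v i. i < m \<Longrightarrow> (v i)\<^sup>2 \<le> \<kappa> * quad m (\<lambda>i j. Q $$ (i, j) / 2) v"
begin

definition Z :: "real mat" where
  "Z = the (mat_inverse Q) * W_zero m W"

lemma Z_carrier: "Z \<in> carrier_mat m l"
  unfolding Z_def using pos_def_inverse(3)[OF Q] W_zero_carrier[OF W] by (rule mult_carrier_mat)

sublocale quadratic_team m "\<lambda>i j. Q $$ (i, j) / 2" \<kappa> "borel_vec l" "\<lambda>i. borel_vec (ls i)"
  "\<lambda>i x. W_obs m ls W i *\<^sub>v x" "\<lambda>i x. (Z *\<^sub>v x) $ i"
proof
  show "0 < \<kappa>" by (rule \<kappa>)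
  show "0 \<le> quad m (\<lambda>i j. Q $$ (i, j) / 2) v" for v by (rule quad_pos_def_nonneg[OF Q])
  show "(v i)\<^sup>2 \<le> \<kappa> * quad m (\<lambda>i j. Q $$ (i, j) / 2) v" if "i < m" for v i
    using that by (rule \<kappa>)
  show "(\<lambda>x. W_obs m ls W i *\<^sub>v x) \<in> measurable (borel_vec l) (borel_vec (ls i))" for i
    by (rule measurable_mult_mat_vec[OF W_obs_carrier[OF W]])
  show "(\<lambda>x. (Z *\<^sub>v x) $ i) \<in> borel_measurable (borel_vec l)" if "i < m" for i
    by (rule measurable_compose[OF measurable_mult_mat_vec[OF Z_carrier] measurable_vec_index[OF that]])
qed

lemma admissible_eq: "admissible = policies m ls"
  unfolding admissible_def policies_def ..

text \<open>
  The cost sees \<open>x\<close> only through \<open>S x\<close> and the observations, so it may be computed at any \<open>z\<close> that produces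
  the same values through \<open>W\<close>; for the \<open>n\<close>-th problem this is \<open>z = R\<^sup>T x\<close>.
\<close>

lemma team_cost_eq_cost:
  assumes S: "S \<in> carrier_mat m n" and x: "x \<in> carrier_vec n" and z: "z \<in> carrier_vec l"
    and Sx: "S *\<^sub>v x = W_zero m W *\<^sub>v z"
    and Hx: "\<And>i. i < m \<Longrightarrow> H i *\<^sub>v x = W_obs m ls W i *\<^sub>v z"
  shows "team_cost Q S (Matrix.vec m (\<lambda>i. \<gamma> i (H i *\<^sub>v x))) x = cost \<gamma> z"
proof -
  let ?u = "Matrix.vec m (\<lambda>i. \<gamma> i (H i *\<^sub>v x))"
  have Zz: "Z *\<^sub>v z = the (mat_inverse Q) *\<^sub>v (S *\<^sub>v x)"
    unfolding Z_def Sx by (rule assoc_mult_mat_vec[OF pos_def_inverse(3)[OF Q] W_zero_carrier[OF W] z])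
  have Zc: "Z *\<^sub>v z \<in> carrier_vec m" using Z_carrier z by simp
  have Qc: "Q \<in> carrier_mat m m" using Q by (simp add: pos_def_def)
  have "team_cost Q S ?u x = quad m (\<lambda>i j. Q $$ (i, j) / 2) (\<lambda>i. (?u + Z *\<^sub>v z) $ i)"
    unfolding team_cost_complete_square[OF Q S vec_carrier x Zz]
    by (rule quad_eq_scalar_prod[OF Qc]) (use Zc in simp)
  also have "\<dots> = cost \<gamma> z"
    unfolding cost_def using carrier_matD(1)[OF Z_carrier] Hx by (intro quad_cong) simp
  finally show ?thesis .
qed

lemma expected_cost_gaussian:
  assumes \<zeta>: "\<zeta> \<in> measurable M (borel_vec l)" and \<gamma>: "\<gamma> \<in> policies m ls"
  shows "expected_cost M m Q (W_zero m W) (W_obs m ls W) \<gamma> \<zeta>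
    = (\<integral>\<^sup>+x. ennreal (cost \<gamma> x) \<partial>distr M (borel_vec l) \<zeta>)"
proof -
  have "expected_cost M m Q (W_zero m W) (W_obs m ls W) \<gamma> \<zeta> = (\<integral>\<^sup>+\<omega>. ennreal (cost \<gamma> (\<zeta> \<omega>)) \<partial>M)"
    unfolding expected_cost_def
  proof (rule nn_integral_cong)
    fix \<omega> assume "\<omega> \<in> space M"
    then have z: "\<zeta> \<omega> \<in> carrier_vec l" using measurable_space[OF \<zeta>] by (simp add: space_borel_vec)
    show "ennreal (team_cost Q (W_zero m W) (Matrix.vec m (\<lambda>i. \<gamma> i (W_obs m ls W i *\<^sub>v \<zeta> \<omega>))) (\<zeta> \<omega>))
        = ennreal (cost \<gamma> (\<zeta> \<omega>))"
      by (subst team_cost_eq_cost[OF W_zero_carrier[OF W] z z]) simp_all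
  qed
  also have "\<dots> = (\<integral>\<^sup>+x. ennreal (cost \<gamma> x) \<partial>distr M (borel_vec l) \<zeta>)"
    using measurable_cost[of \<gamma>] \<gamma> by (intro nn_integral_distr[symmetric] \<zeta>) (simp_all add: admissible_eq)
  finally show ?thesis .
qed

lemma expected_cost_projected:
  assumes \<xi>: "\<xi> \<in> measurable M (borel_vec n)" and R: "R \<in> carrier_mat n l"
    and \<gamma>: "\<gamma> \<in> policies m ls"
  shows "expected_cost M m Q (S_of m W R) (H_of m ls W R) \<gamma> \<xi>
    = (\<integral>\<^sup>+x. ennreal (cost \<gamma> x) \<partial>distr M (borel_vec l) (\<lambda>\<omega>. transpose_mat R *\<^sub>v \<xi> \<omega>))"
proof -
  have Rt: "transpose_mat R \<in> carrier_mat l n" using R by simp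
  have Rm: "(\<lambda>\<omega>. transpose_mat R *\<^sub>v \<xi> \<omega>) \<in> measurable M (borel_vec l)"
    by (rule measurable_compose[OF \<xi> measurable_mult_mat_vec[OF Rt]])
  have "expected_cost M m Q (S_of m W R) (H_of m ls W R) \<gamma> \<xi>
      = (\<integral>\<^sup>+\<omega>. ennreal (cost \<gamma> (transpose_mat R *\<^sub>v \<xi> \<omega>)) \<partial>M)"
    unfolding expected_cost_def
  proof (rule nn_integral_cong)
    fix \<omega> assume "\<omega> \<in> space M"
    then have x: "\<xi> \<omega> \<in> carrier_vec n" using measurable_space[OF \<xi>] by (simp add: space_borel_vec)
    have S: "S_of m W R \<in> carrier_mat m n"
      unfolding S_of_def by (rule mult_carrier_mat[OF W_zero_carrier[OF W] Rt])
    have z: "transpose_mat R *\<^sub>v \<xi> \<omega> \<in> carrier_vec l" using Rt x by simp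
    have Sx: "S_of m W R *\<^sub>v \<xi> \<omega> = W_zero m W *\<^sub>v (transpose_mat R *\<^sub>v \<xi> \<omega>)"
      unfolding S_of_def by (rule assoc_mult_mat_vec[OF W_zero_carrier[OF W] Rt x])
    have Hx: "H_of m ls W R i *\<^sub>v \<xi> \<omega> = W_obs m ls W i *\<^sub>v (transpose_mat R *\<^sub>v \<xi> \<omega>)" for i
      unfolding H_of_def by (rule assoc_mult_mat_vec[OF W_obs_carrier[OF W] Rt x])
    show "ennreal (team_cost Q (S_of m W R) (Matrix.vec m (\<lambda>i. \<gamma> i (H_of m ls W R i *\<^sub>v \<xi> \<omega>))) (\<xi> \<omega>))
        = ennreal (cost \<gamma> (transpose_mat R *\<^sub>v \<xi> \<omega>))"
      by (simp only: team_cost_eq_cost[OF S x z Sx Hx])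
  qed
  also have "\<dots> = (\<integral>\<^sup>+x. ennreal (cost \<gamma> x) \<partial>distr M (borel_vec l) (\<lambda>\<omega>. transpose_mat R *\<^sub>v \<xi> \<omega>))"
    using measurable_cost[of \<gamma>] \<gamma> by (intro nn_integral_distr[symmetric] Rm) (simp_all add: admissible_eq)
  finally show ?thesis .
qed

text \<open>
  The convergence for one deterministic sequence of frames: all that randomness has to provide is
  that the projected laws are eventually close to the Gaussian one.
\<close>

theorem optimal_cost_tendsto_gaussian:
  fixes R :: "nat \<Rightarrow> real mat" and \<epsilon> r :: "nat \<Rightarrow> real"
  assumes prob: "prob_space M"
    and \<zeta>: "distributed M (lborel_vec l) \<zeta> (\<lambda>x. ennreal (std_normal_vec_density l x))"
    and iso: "eventually (\<lambda>n. isotropic M n (\<xi> n)) sequentially"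
    and R: "eventually (\<lambda>n. R n \<in> stiefel n l) sequentially"
    and near: "eventually (\<lambda>n. near_gaussian (\<epsilon> n) (r n) l
        (distr M (borel_vec l) (\<lambda>\<omega>. transpose_mat (R n) *\<^sub>v \<xi> n \<omega>))) sequentially"
    and \<epsilon>: "\<epsilon> \<longlonglongrightarrow> 0" and r: "filterlim r at_top sequentially"
    and sol: "eventually (\<lambda>n. team_solution M m ls Q (S_of m W (R n)) (H_of m ls W (R n)) (\<xi> n) (\<gamma> n)) sequentially"
    and solG: "team_solution M m ls Q (W_zero m W) (W_obs m ls W) \<zeta> \<gamma>G"
  shows "(\<lambda>n. expected_cost M m Q (S_of m W (R n)) (H_of m ls W (R n)) (\<gamma> n) (\<xi> n))
    \<longlonglongrightarrow> expected_cost M m Q (W_zero m W) (W_obs m ls W) \<gamma>G \<zeta>"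
proof -
  interpret prob_space M by (rule prob)
  have \<zeta>m: "\<zeta> \<in> measurable M (borel_vec l)"
    using \<zeta> by (simp add: distributed_def measurable_to_lborel_vec)
  define \<mu> where "\<mu> = distr M (borel_vec l) \<zeta>"
  define X where "X n \<omega> = transpose_mat (R n) *\<^sub>v \<xi> n \<omega>" for n \<omega>
  define \<nu> where "\<nu> n = distr M (borel_vec l) (X n)" for n
  define H where "H x = 1 + (\<Sum>j<l. (x $ j)\<^sup>2)" for x :: "real vec"
  define A' where "A' k = {x \<in> carrier_vec l. norm_vec x \<le> real k}" for k
  have good: "eventually (\<lambda>n. X n \<in> measurable M (borel_vec l) \<and> \<xi> n \<in> measurable M (borel_vec n)
      \<and> R n \<in> carrier_mat n l) sequentially"
    using iso R
  proof eventually_elim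
    case (elim n)
    then have x: "\<xi> n \<in> measurable M (borel_vec n)" and Rc: "R n \<in> carrier_mat n l"
      by (auto simp: isotropic_def stiefel_def)
    then have "X n \<in> measurable M (borel_vec l)"
      unfolding X_def by (intro measurable_compose[OF x measurable_mult_mat_vec]) simp
    with x Rc show ?case by simp
  qed
  have \<mu>_density: "distributed \<mu> (lborel_vec l) (\<lambda>x. x) (\<lambda>x. ennreal (std_normal_vec_density l x))"
  proof -
    have [measurable]: "\<zeta> \<in> measurable M (borel_vec l)" "(\<lambda>x. x) \<in> measurable (borel_vec l) (lborel_vec l)"
      using \<zeta>m by (simp_all add: measurable_to_lborel_vec)
    have "distr \<mu> (lborel_vec l) (\<lambda>x. x) = distr M (lborel_vec l) \<zeta>"
      unfolding \<mu>_def by (subst distr_distr) (auto simp: comp_def)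
    then show ?thesis using \<zeta> unfolding distributed_def by (auto simp: \<mu>_def)
  qed
  have H_\<mu>: "(\<integral>\<^sup>+x. ennreal (H x) \<partial>\<mu>) = 1 + of_nat l"
    unfolding H_def
  proof (rule unit_second_moments_integral)
    show "prob_space \<mu>" unfolding \<mu>_def by (rule prob_space_distr[OF \<zeta>m])
    fix j assume j: "j < l"
    have "(\<lambda>x. ennreal ((x $ j)\<^sup>2)) \<in> borel_measurable (lborel_vec l)"
      using measurable_vec_index[OF j] by (simp add: measurable_lborel_vec_iff)
    from distributed_nn_integral[OF \<mu>_density this]
    have "(\<integral>\<^sup>+x. ennreal ((x $ j)\<^sup>2) \<partial>\<mu>)
        = (\<integral>\<^sup>+x. ennreal (std_normal_vec_density l x * (x $ j)\<^sup>2) \<partial>lborel_vec l)"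
      using std_normal_vec_density_pos[THEN less_imp_le] by (simp add: ennreal_mult)
    then show "(\<integral>\<^sup>+x. ennreal ((x $ j)\<^sup>2) \<partial>\<mu>) = 1"
      by (simp only: gaussian_second_moment[OF j])
  qed (simp add: \<mu>_def)
  have H_\<nu>: "eventually (\<lambda>n. (\<integral>\<^sup>+x. ennreal (H x) \<partial>\<nu> n) = (\<integral>\<^sup>+x. ennreal (H x) \<partial>\<mu>)) sequentially"
    using good iso R
  proof eventually_elim
    case (elim n)
    have "(\<integral>\<^sup>+x. ennreal (H x) \<partial>\<nu> n) = 1 + of_nat l"
      unfolding H_def
    proof (rule unit_second_moments_integral)
      show "prob_space (\<nu> n)" unfolding \<nu>_def using elim by (intro prob_space_distr) simp
      fix j assume j: "j < l"
      have "(\<integral>\<^sup>+x. ennreal ((x $ j)\<^sup>2) \<partial>\<nu> n) = (\<integral>\<^sup>+\<omega>. ennreal ((X n \<omega> $ j)\<^sup>2) \<partial>M)"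
        unfolding \<nu>_def using elim measurable_vec_index[OF j] by (intro nn_integral_distr) simp_all
      also have "\<dots> = 1"
        unfolding X_def by (rule isotropic_projection_second_moment[OF elim(2,3) j])
      finally show "(\<integral>\<^sup>+x. ennreal ((x $ j)\<^sup>2) \<partial>\<nu> n) = 1" .
    qed (simp add: \<nu>_def)
    then show ?case by (simp only: H_\<mu>)
  qed
  have A_sets: "A' k \<in> sets (borel_vec l)" for k unfolding A'_def by (rule norm_ball_sets)
  have lim: "(\<lambda>n. \<integral>\<^sup>+x. ennreal (cost (\<gamma> n) x) \<partial>\<nu> n) \<longlonglongrightarrow> (\<integral>\<^sup>+x. ennreal (cost \<gamma>G x) \<partial>\<mu>)"
  proof (rule minimal_cost_tendsto[where H = H and A' = A' and D = "\<Sum>i<m. \<Sum>j<l. (Z $$ (i, j))\<^sup>2"])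
    show "sets \<mu> = sets (borel_vec l)" "eventually (\<lambda>n. sets (\<nu> n) = sets (borel_vec l)) sequentially"
      by (simp_all add: \<mu>_def \<nu>_def)
    show "A' k \<in> sets \<mu>" for k using A_sets by (simp add: \<mu>_def)
    show "incseq A'" unfolding A'_def incseq_def by (auto intro: order_trans)
    show "(\<Union>k. A' k) = space \<mu>"
    proof -
      have "\<exists>k. norm_vec x \<le> real k" for x by (rule real_arch_simple)
      then show ?thesis unfolding A'_def \<mu>_def by (auto simp: space_borel_vec)
    qed
    fix c :: real and k :: nat assume c: "0 \<le> c" "c < 1"
    have "eventually (\<lambda>n. \<epsilon> n < 1 - c) sequentially"
      using order_tendstoD(2)[OF \<epsilon>, of "1 - c"] c by simp
    moreover have "eventually (\<lambda>n. real k \<le> r n) sequentially"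
      using r by (simp add: filterlim_at_top)
    ultimately show "eventually (\<lambda>n. \<forall>g\<in>borel_measurable (borel_vec l).
        ennreal c * (\<integral>\<^sup>+x. g x * indicator (A' k) x \<partial>\<mu>) \<le> (\<integral>\<^sup>+x. g x \<partial>\<nu> n)) sequentially"
      using near
    proof eventually_elim
      case (elim n)
      then have "near_gaussian (\<epsilon> n) (r n) l (\<nu> n)" by (simp add: \<nu>_def X_def[abs_def])
      from near_gaussian_minorization[OF this \<mu>_density c(1) _ elim(2) _ A'_def A_sets] elim(1)
      show ?case by simp
    qed
  next
    show "H \<in> borel_measurable (borel_vec l)"
      unfolding H_def[abs_def] using measurable_vec_index
      by (intro borel_measurable_add borel_measurable_const borel_measurable_sum borel_measurable_power) auto
    show "1 \<le> H x" for x unfolding H_def by (simp add: sum_nonneg)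
    show "((Z *\<^sub>v x) $ i)\<^sup>2 \<le> (\<Sum>i<m. \<Sum>j<l. (Z $$ (i, j))\<^sup>2) * H x"
      if i: "i < m" and x: "x \<in> space (borel_vec l)" for i x
    proof -
      have "((Z *\<^sub>v x) $ i)\<^sup>2 \<le> (\<Sum>i<m. \<Sum>j<l. (Z $$ (i, j))\<^sup>2) * (\<Sum>j<l. (x $ j)\<^sup>2)"
        by (rule mult_mat_vec_square_le[OF Z_carrier _ i]) (use x in \<open>simp add: space_borel_vec\<close>)
      also have "\<dots> \<le> (\<Sum>i<m. \<Sum>j<l. (Z $$ (i, j))\<^sup>2) * H x"
        unfolding H_def by (intro mult_left_mono sum_nonneg) auto
      finally show ?thesis .
    qed
    show "(\<integral>\<^sup>+x. ennreal (H x) \<partial>\<mu>) < \<infinity>" unfolding H_\<mu> by (simp add: less_top[symmetric])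
    show "eventually (\<lambda>n. \<gamma> n \<in> admissible) sequentially"
      using sol by eventually_elim (simp add: team_solution_def admissible_eq)
    show "eventually (\<lambda>n. \<forall>\<eta>\<in>admissible. (\<integral>\<^sup>+x. ennreal (cost (\<gamma> n) x) \<partial>\<nu> n)
        \<le> (\<integral>\<^sup>+x. ennreal (cost \<eta> x) \<partial>\<nu> n)) sequentially"
      using sol good
    proof eventually_elim
      case (elim n)
      have eq: "expected_cost M m Q (S_of m W (R n)) (H_of m ls W (R n)) \<eta> (\<xi> n)
          = (\<integral>\<^sup>+x. ennreal (cost \<eta> x) \<partial>\<nu> n)" if "\<eta> \<in> policies m ls" for \<eta>
        unfolding \<nu>_def X_def[abs_def] using elim(2) that by (intro expected_cost_projected) auto
      show ?case
        using elim(1) unfolding team_solution_def admissible_eq by (auto simp: eq)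
    qed
    show "\<gamma>G \<in> admissible" using solG by (simp add: team_solution_def admissible_eq)
    show "(\<integral>\<^sup>+x. ennreal (cost \<gamma>G x) \<partial>\<mu>) \<le> (\<integral>\<^sup>+x. ennreal (cost \<eta> x) \<partial>\<mu>)" if "\<eta> \<in> admissible" for \<eta>
    proof -
      have \<eta>: "\<eta> \<in> policies m ls" and G: "\<gamma>G \<in> policies m ls"
        using that solG by (simp_all add: team_solution_def admissible_eq)
      show ?thesis
        using solG \<eta> unfolding team_solution_def \<mu>_def
          expected_cost_gaussian[OF \<zeta>m \<eta>, symmetric] expected_cost_gaussian[OF \<zeta>m G, symmetric]
        by blast
    qed
  qed (rule H_\<nu>)
  have "eventually (\<lambda>n. (\<integral>\<^sup>+x. ennreal (cost (\<gamma> n) x) \<partial>\<nu> n)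
      = expected_cost M m Q (S_of m W (R n)) (H_of m ls W (R n)) (\<gamma> n) (\<xi> n)) sequentially"
    using sol good
    by eventually_elim (auto simp: \<nu>_def X_def[abs_def] team_solution_def expected_cost_projected)
  from Lim_transform_eventually[OF lim this]
  show ?thesis
    using solG by (simp add: \<mu>_def expected_cost_gaussian[OF \<zeta>m] team_solution_def)
qed

end

section \<open>Almost sure convergence\<close>

lemma summable_exp_neg_powr:
  assumes "0 < (c::real)"
  shows "summable (\<lambda>n. exp (- (real n powr c)))"
proof (rule summable_comparison_test_ev)
  have "eventually (\<lambda>n. exp (- (real n powr c)) \<le> real n powr (-2)) sequentially"
    using assms by real_asymp
  then show "eventually (\<lambda>n. norm (exp (- (real n powr c))) \<le> real n powr (-2)) sequentially"
    by simp
  show "summable (\<lambda>n. real n powr (-2))"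
    by (simp add: summable_real_powr_iff)
qed

text \<open>
  The first Borel-Cantelli lemma.  The lower bound on the measure makes \<open>G n\<close> measurable for large \<open>n\<close>:
  sets outside the sigma-algebra have measure 0, whereas \<open>1 - b n\<close> is positive as soon as \<open>b n < 1\<close>.
\<close>

lemma AE_eventually_in_good_sets:
  fixes X :: "nat \<Rightarrow> 'a \<Rightarrow> 'b"
  assumes prob: "prob_space M" and b: "summable b"
    and good: "eventually (\<lambda>n. X n \<in> measurable M (S n) \<and> 1 - b n \<le> measure (distr M (S n) (X n)) (G n)) sequentially"
  shows "AE \<omega> in M. eventually (\<lambda>n. X n \<omega> \<in> G n) sequentially"
proof -
  interpret prob_space M by (rule prob)
  define P where "P n \<longleftrightarrow> X n \<in> measurable M (S n) \<and> 1 - b n \<le> measure (distr M (S n) (X n)) (G n) \<and> b n < 1" for n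
  define B where "B n = (if P n then X n -` (space (S n) - G n) \<inter> space M else {})" for n
  have G: "G n \<in> sets (S n)" if "P n" for n
  proof (rule ccontr)
    assume "G n \<notin> sets (S n)"
    then have "measure (distr M (S n) (X n)) (G n) = 0"
      by (intro measure_notin_sets) simp
    then show False using that unfolding P_def by linarith
  qed
  have B_sets: "B n \<in> sets M" for n
    using G[of n] unfolding B_def by (auto simp: P_def intro!: measurable_sets)
  have "eventually (\<lambda>n. b n < 1) sequentially"
    using order_tendstoD(2)[OF summable_LIMSEQ_zero[OF b], of 1] by simp
  with good have ev: "eventually P sequentially"
    unfolding P_def by eventually_elim simp
  have B_le: "measure M (B n) \<le> b n" if "P n" for n
  proof -
    have Xm: "X n \<in> measurable M (S n)" using that by (simp add: P_def)
    interpret D: prob_space "distr M (S n) (X n)" by (rule prob_space_distr[OF Xm])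
    have "measure M (B n) = measure (distr M (S n) (X n)) (space (S n) - G n)"
      unfolding B_def using that G[OF that] by (simp add: measure_distr[OF Xm])
    also have "\<dots> = 1 - measure (distr M (S n) (X n)) (G n)"
      using D.prob_compl[of "G n"] G[OF that] by simp
    finally show ?thesis using that by (simp add: P_def)
  qed
  have "summable (\<lambda>n. measure M (B n))"
    by (rule summable_comparison_test_ev[OF _ b]) (use ev in \<open>eventually_elim, simp add: B_le\<close>)
  then have "AE \<omega> in M. eventually (\<lambda>n. \<omega> \<in> space M - B n) sequentially"
    by (intro borel_cantelli_AE1 B_sets) (auto simp: emeasure_eq_measure)
  then show ?thesis
  proof eventually_elim
    case (elim \<omega>)
    with ev show ?case
    proof eventually_elim
      case (elim n)
      then have "X n \<omega> \<in> space (S n)" by (auto simp: P_def intro: measurable_space)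
      with elim show ?case by (auto simp: B_def)
    qed
  qed
qed

theorem mainTheorem1:
  fixes C c1 c2 c3 c4 :: real
    and m l :: nat and ls :: "nat \<Rightarrow> nat" and Q W :: "real mat"
    and M :: "'a measure"
    and \<xi> :: "nat \<Rightarrow> 'a \<Rightarrow> real vec" and \<zeta> :: "'a \<Rightarrow> real vec"
    and R :: "nat \<Rightarrow> 'a \<Rightarrow> real mat"
    and \<gamma> :: "nat \<Rightarrow> real mat \<Rightarrow> nat \<Rightarrow> real vec \<Rightarrow> real"
    and \<gamma>G :: "nat \<Rightarrow> real vec \<Rightarrow> real"
    and N :: "nat set"
  assumes constants: "C > 0" "c1 > 0" "c2 > 0" "c3 > 0" "c4 > 0"
    and ek: "eldan_klartag C c1 c2 c3 c4"
    and l: "l = m + (\<Sum>i<m. ls i)"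
    and Q: "pos_def m Q"
    and W: "W \<in> carrier_mat l l"
    and N: "N = {n. real n \<ge> real l powr (1 / c1)}"
    and prob: "prob_space M"
    and xi_isotropic: "\<And>n. n \<in> N \<Longrightarrow> isotropic M n (\<xi> n)"
    and xi_log_concave: "\<And>n. n \<in> N \<Longrightarrow> has_log_concave_density M n (\<xi> n)"
    and zeta: "distributed M (lborel_vec l) \<zeta> (\<lambda>x. ennreal (std_normal_vec_density l x))"
    and R_uniform: "\<And>n. n \<in> N \<Longrightarrow>
          R n \<in> measurable M (borel_mat n l) \<and>
          stiefel_uniform n l (distr M (borel_mat n l) (R n))"
    and R_indep: "prob_space.indep_vars M (\<lambda>n. borel_mat n l) R N"
    and R_xi_indep: "indep_rvs M
          (\<Pi>\<^sub>M n\<in>N. borel_mat n l) (\<lambda>\<omega>. \<lambda>n\<in>N. R n \<omega>)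
          (\<Pi>\<^sub>M n\<in>N. borel_vec n) (\<lambda>\<omega>. \<lambda>n\<in>N. \<xi> n \<omega>)"
    and full_rank: "\<And>n. n \<in> N \<Longrightarrow>
          AE \<omega> in M. \<forall>i<m. full_row_rank (H_of m ls W (R n \<omega>) i)"
    and solution: "\<And>n. n \<in> N \<Longrightarrow>
          AE \<omega> in M. team_solution M m ls Q (S_of m W (R n \<omega>)) (H_of m ls W (R n \<omega>))
            (\<xi> n) (\<gamma> n (R n \<omega>))"
    and gauss_solution: "team_solution M m ls Q (W_zero m W) (W_obs m ls W) \<zeta> \<gamma>G"
  shows "AE \<omega> in M.
    (\<lambda>n. expected_cost M m Q (S_of m W (R n \<omega>)) (H_of m ls W (R n \<omega>)) (\<gamma> n (R n \<omega>)) (\<xi> n))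
      \<longlonglongrightarrow> expected_cost M m Q (W_zero m W) (W_obs m ls W) \<gamma>G \<zeta>"
proof (cases "m = 0")
  case True
  \<comment> \<open>Without players \<open>l\<close> is 0, which the theorem of Eldan and Klartag excludes; all costs vanish.\<close>
  have "expected_cost M m Q (S_of m W R') H \<gamma>' X = 0" "expected_cost M m Q (W_zero m W) H \<gamma>' X = 0"
    for R' H \<gamma>' and X :: "'a \<Rightarrow> real vec"
    using Q True
    by (auto intro!: expected_cost_no_players simp: S_of_def W_zero_def rows_from_def)
  then show ?thesis by simp
next
  case False
  interpret prob_space M by (rule prob)
  obtain \<kappa> where \<kappa>: "0 < \<kappa>" "\<And>v i. i < m \<Longrightarrow> (v i)\<^sup>2 \<le> \<kappa> * quad m (\<lambda>i j. Q $$ (i, j) / 2) v"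
    using pos_def_coercive[OF Q] by blast
  interpret static_team m l ls Q W \<kappa>
    by unfold_locales (rule Q W \<kappa>; assumption?)+
  have l1: "1 \<le> l" using False l by simp
  have N_ev: "eventually (\<lambda>n. n \<in> N) sequentially"
  proof -
    have "eventually (\<lambda>n. real l powr (1 / c1) \<le> real n) sequentially"
      using filterlim_real_sequentially by (simp add: filterlim_at_top)
    then show ?thesis by (simp add: N)
  qed
  define G where "G n = {R' \<in> space (borel_mat n l). \<exists>f. (\<forall>x. 0 \<le> f x) \<and>
      distributed (distr M (borel_vec n) (\<xi> n)) (lborel_vec l) (\<lambda>x. transpose_mat R' *\<^sub>v x) (\<lambda>x. ennreal (f x)) \<and>
      (\<forall>x\<in>carrier_vec l. norm_vec x \<le> real n powr c4 \<longrightarrow>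
         \<bar>f x / std_normal_vec_density l x - 1\<bar> \<le> C / real n powr c3)}" for n
  have \<xi>_meas: "\<xi> n \<in> measurable M (borel_vec n)" if "n \<in> N" for n
    using xi_isotropic[OF that] by (simp add: isotropic_def)
  have "AE \<omega> in M. eventually (\<lambda>n. R n \<omega> \<in> G n) sequentially"
  proof (rule AE_eventually_in_good_sets[OF prob])
    show "summable (\<lambda>n. C * exp (- (real n powr c2)))"
      by (intro summable_mult summable_exp_neg_powr constants)
    show "eventually (\<lambda>n. R n \<in> measurable M (borel_mat n l) \<and>
        1 - C * exp (- (real n powr c2)) \<le> measure (distr M (borel_mat n l) (R n)) (G n)) sequentially"
      using N_ev
    proof eventually_elim
      case (elim n)
      have "real l = (real l powr (1 / c1)) powr c1"
        using l1 constants by (simp add: powr_powr)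
      also have "\<dots> \<le> real n powr c1"
        using elim constants by (intro powr_mono2) (auto simp: N)
      finally have "real l \<le> real n powr c1" .
      moreover have "prob_space (distr M (borel_vec n) (\<xi> n))"
        by (rule prob_space_distr[OF \<xi>_meas[OF elim]])
      ultimately have "1 - C * exp (- (real n powr c2)) \<le> measure (distr M (borel_mat n l) (R n))
          {R' \<in> space (distr M (borel_mat n l) (R n)). \<exists>f. (\<forall>x. 0 \<le> f x) \<and>
            distributed (distr M (borel_vec n) (\<xi> n)) (lborel_vec l) (\<lambda>x. transpose_mat R' *\<^sub>v x) (\<lambda>x. ennreal (f x)) \<and>
            (\<forall>x\<in>carrier_vec l. norm_vec x \<le> real n powr c4 \<longrightarrow>
               \<bar>f x / std_normal_vec_density l x - 1\<bar> \<le> C / real n powr c3)}"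
        using l1 R_uniform[OF elim] isotropic_distr[OF xi_isotropic[OF elim]]
          log_concave_density_distr[OF \<xi>_meas[OF elim] xi_log_concave[OF elim]]
        by (intro ek[unfolded eldan_klartag_def, rule_format]) simp_all
      then show ?case using R_uniform[OF elim] by (simp add: G_def)
    qed
  qed
  moreover have "AE \<omega> in M. \<forall>n. n \<in> N \<longrightarrow> R n \<omega> \<in> stiefel n l"
  proof (subst AE_all_countable, intro allI)
    fix n
    show "AE \<omega> in M. n \<in> N \<longrightarrow> R n \<omega> \<in> stiefel n l"
    proof (cases "n \<in> N")
      case True
      then have "AE R' in distr M (borel_mat n l) (R n). R' \<in> stiefel n l"
        using R_uniform by (simp add: stiefel_uniform_def)
      then show ?thesis
        using R_uniform[OF True] by (auto dest: AE_distrD)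
    qed simp
  qed
  moreover have "AE \<omega> in M. \<forall>n. n \<in> N \<longrightarrow> team_solution M m ls Q (S_of m W (R n \<omega>)) (H_of m ls W (R n \<omega>))
      (\<xi> n) (\<gamma> n (R n \<omega>))"
    using solution by (subst AE_all_countable) auto
  ultimately show ?thesis
  proof eventually_elim
    case (elim \<omega>)
    show ?case
    proof (rule optimal_cost_tendsto_gaussian[OF prob zeta _ _ _ _ _ _ gauss_solution,
          where \<epsilon> = "\<lambda>n. C / real n powr c3" and r = "\<lambda>n. real n powr c4"])
      show "eventually (\<lambda>n. isotropic M n (\<xi> n)) sequentially"
        using N_ev by eventually_elim (rule xi_isotropic)
      show "eventually (\<lambda>n. R n \<omega> \<in> stiefel n l) sequentially"
        using N_ev by eventually_elim (use elim(2) in blast)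
      show "eventually (\<lambda>n. near_gaussian (C / real n powr c3) (real n powr c4) l
          (distr M (borel_vec l) (\<lambda>\<omega>'. transpose_mat (R n \<omega>) *\<^sub>v \<xi> n \<omega>'))) sequentially"
        using N_ev elim(1)
      proof eventually_elim
        case (elim n)
        then show ?case
          by (intro near_gaussian_of_projection[OF \<xi>_meas]) (auto simp: G_def space_borel_mat)
      qed
      show "(\<lambda>n. C / real n powr c3) \<longlonglongrightarrow> 0"
        using constants by real_asymp
      show "filterlim (\<lambda>n. real n powr c4) at_top sequentially"
        using constants by real_asymp
      show "eventually (\<lambda>n. team_solution M m ls Q (S_of m W (R n \<omega>)) (H_of m ls W (R n \<omega>)) (\<xi> n)
          (\<gamma> n (R n \<omega>))) sequentially"
        using N_ev by eventually_elim (use elim(3) in blast)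
    qed
  qed
qed

end
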